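(* Let $n\ge 1$ and let $L_n$ be the graph described in the context, with its sets of blue and green endpoints. Let ${\mathcal A}_n$ be the set of admissible colorings of $L_n$. For $c\in{\mathcal A}_n$, let $\pi_B(c)$ be the blue pairing of $c$, let $\pi_G(c)$ be the green pairing of $c$, and let $\ell(c)$ be the number of cycles in the blue subgraph of $c$ plus the number of cycles in the green subgraph of $c$. For a pairing $\pi_B$ of the blue endpoints, a pairing $\pi_G$ of the green endpoints and an integer $\ell$, let $${\mathcal A}_n(\pi_B,\pi_G,\ell)=\{c\in{\mathcal A}_n:\ \pi_B(c)=\pi_B,\ \pi_G(c)=\pi_G,\ \ell(c)=\ell\}.$$ Let $\pi_B'$ be $\pi_B$ rotated one step clockwise, and let $\pi_G'$ be $\pi_G$ rotated one step counterclockwise (both rotations as defined in the context). Then there is a bijection between ${\mathcal A}_n(\pi_B,\pi_G,\ell)$ and ${\mathcal A}_n(\pi_B',\pi_G',\ell)$.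
   Context: **The graph.** Work in the square grid $\mathbb{Z}^2$ with the standard orientation ($x$ to the right, $y$ upward). Let $L_n$ be the following graph. - Its interior vertices are the $n^2$ points $(x,y)$ with $1\le x,y\le n$. - Its edges are all grid edges incident to an interior vertex. - Its endpoints are the $4n$ further vertices incident to these edges. These are the points with one coordinate in $\{1,\dots,n\}$ and the other coordinate in $\{0,n+1\}$. Each endpoint has degree 1. **Admissible colorings.** An admissible coloring of $L_n$ colors each edge blue or green so that: - every interior vertex is incident to exactly two blue and two green edges; - the edge at an endpoint $(x,y)$ with $x\in\{0,n+1\}$ is blue if $x+y$ is odd and green otherwise; - the edge at an endpoint $(x,y)$ with $y\in\{0,n+1\}$ is blue if $x+y$ is even and green otherwise. An endpoint gets the color of its edge. Thus the endpoints alternate blue and green around the boundary, giving $2n$ blue and $2n$ green endpoints. These colorings are in bijection with $n\times n$ alternating sign matrices (via the six-vertex/square-ice model), and ${\mathcal A}_n$ denotes this set of colorings. **Subgraphs and pairings.** In the blue subgraph (blue edges only), interior vertices have degree 2 and blue endpoints have degree 1. Hence its components are cycles and paths, and each path joins two blue endpoints. The blue pairing is the perfect matching of the blue endpoints given by these paths. The green subgraph and the green pairing are defined in the same way. **Rotations.** Rotating a pairing of the blue endpoints one step clockwise means replacing each blue endpoint by the next blue endpoint in clockwise order around the boundary of the square. Rotating a pairing of the green endpoints one step counterclockwise means replacing each green endpoint by the next green endpoint in counterclockwise order around the boundary. *)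

theory Defs
  imports Main "HOL-Library.FuncSet" "HOL-Library.Disjoint_Sets"
begin

type_synonym vertex = "int \<times> int"

datatype color = Blue | Green

definition interior_vertices :: "nat \<Rightarrow> vertex set" where
  "interior_vertices n = {1..int n} \<times> {1..int n}"

definition endpoints :: "nat \<Rightarrow> vertex set" where
  "endpoints n = {0, int n + 1} \<times> {1..int n} \<union> {1..int n} \<times> {0, int n + 1}"

fun grid_adjacent :: "vertex \<Rightarrow> vertex \<Rightarrow> bool" where
  "grid_adjacent (x, y) (x', y') \<longleftrightarrow> \<bar>x - x'\<bar> + \<bar>y - y'\<bar> = 1"

definition edges :: "nat \<Rightarrow> vertex set set" where
  "edges n = {{u, v} | u v. u \<in> interior_vertices n \<and> grid_adjacent u v}"

fun endpoint_color :: "nat \<Rightarrow> vertex \<Rightarrow> color" where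
  "endpoint_color n (x, y) =
     (if x \<in> {0, int n + 1} then (if odd (x + y) then Blue else Green)
      else (if even (x + y) then Blue else Green))"

definition colored_endpoints :: "nat \<Rightarrow> color \<Rightarrow> vertex set" where
  "colored_endpoints n k = {v \<in> endpoints n. endpoint_color n v = k}"

text \<open>Colorings are extensional on the edge set, so that distinct functions
  are distinct colorings.\<close>

definition admissible_colorings :: "nat \<Rightarrow> (vertex set \<Rightarrow> color) set" where
  "admissible_colorings n = {c \<in> edges n \<rightarrow>\<^sub>E UNIV.
     (\<forall>v \<in> interior_vertices n. \<forall>k. card {e \<in> edges n. v \<in> e \<and> c e = k} = 2) \<and>
     (\<forall>v \<in> endpoints n. \<forall>e \<in> edges n. v \<in> e \<longrightarrow> c e = endpoint_color n v)}"

definition colored_edges :: "nat \<Rightarrow> (vertex set \<Rightarrow> color) \<Rightarrow> color \<Rightarrow> vertex set set" where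
  "colored_edges n c k = {e \<in> edges n. c e = k}"

definition is_path :: "'a set set \<Rightarrow> 'a list \<Rightarrow> bool" where
  "is_path E vs \<longleftrightarrow> vs \<noteq> [] \<and> distinct vs \<and> successively (\<lambda>u v. {u, v} \<in> E) vs"

definition closed_edges :: "'a list \<Rightarrow> 'a set set" where
  "closed_edges vs = set (map2 (\<lambda>u v. {u, v}) vs (rotate1 vs))"

text \<open>A cycle is identified with its set of edges, so that it is counted once,
  independently of a starting vertex and a direction of traversal.\<close>

definition cycles :: "'a set set \<Rightarrow> 'a set set set" where
  "cycles E = {closed_edges vs | vs. distinct vs \<and> 3 \<le> length vs \<and> closed_edges vs \<subseteq> E}"

definition coloring_pairing :: "nat \<Rightarrow> color \<Rightarrow> (vertex set \<Rightarrow> color) \<Rightarrow> vertex set set" where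
  "coloring_pairing n k c = {{u, v} | u v.
     u \<in> colored_endpoints n k \<and> v \<in> colored_endpoints n k \<and> u \<noteq> v \<and>
     (\<exists>vs. is_path (colored_edges n c k) vs \<and> hd vs = u \<and> last vs = v)}"

definition num_cycles :: "nat \<Rightarrow> (vertex set \<Rightarrow> color) \<Rightarrow> nat" where
  "num_cycles n c =
     card (cycles (colored_edges n c Blue)) + card (cycles (colored_edges n c Green))"

definition is_pairing :: "'a set \<Rightarrow> 'a set set \<Rightarrow> bool" where
  "is_pairing S P \<longleftrightarrow> partition_on S P \<and> (\<forall>p \<in> P. card p = 2)"

definition colorings_with ::
    "nat \<Rightarrow> vertex set set \<Rightarrow> vertex set set \<Rightarrow> int \<Rightarrow> (vertex set \<Rightarrow> color) set" where
  "colorings_with n \<pi>B \<pi>G l = {c \<in> admissible_colorings n.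
     coloring_pairing n Blue c = \<pi>B \<and> coloring_pairing n Green c = \<pi>G \<and> int (num_cycles n c) = l}"

text \<open>The endpoints in clockwise order (with y pointing upward), from the left end
  of the top side: top, right, bottom, left.\<close>

definition clockwise_endpoints :: "nat \<Rightarrow> vertex list" where
  "clockwise_endpoints n =
     map (\<lambda>i. (i, int n + 1)) [1..int n] @
     map (\<lambda>i. (int n + 1, i)) (rev [1..int n]) @
     map (\<lambda>i. (i, 0)) (rev [1..int n]) @
     map (\<lambda>i. (0, i)) [1..int n]"

text \<open>The element following \<open>x\<close> in a list of distinct elements read cyclically;
  used only for \<open>x\<close> in the list.\<close>

definition cyclic_next :: "'a list \<Rightarrow> 'a \<Rightarrow> 'a" where
  "cyclic_next xs x = the (map_of (zip xs (rotate1 xs)) x)"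

definition next_clockwise :: "nat \<Rightarrow> color \<Rightarrow> vertex \<Rightarrow> vertex" where
  "next_clockwise n k =
     cyclic_next (filter (\<lambda>v. endpoint_color n v = k) (clockwise_endpoints n))"

definition next_counterclockwise :: "nat \<Rightarrow> color \<Rightarrow> vertex \<Rightarrow> vertex" where
  "next_counterclockwise n k =
     cyclic_next (filter (\<lambda>v. endpoint_color n v = k) (rev (clockwise_endpoints n)))"

definition rotate_pairing :: "('a \<Rightarrow> 'a) \<Rightarrow> 'a set set \<Rightarrow> 'a set set" where
  "rotate_pairing next_point P = (\<lambda>p. next_point ` p) ` P"

end

theory Submission imports Defs begin

text \<open>Wieland's gyration. Divide the square into unit cells, colored like a chessboard. The
  half-step for one parity flips the color of every edge, except that a cell of that parity whose
  four sides alternate in color is left alone. Call a vertex split if in each of its two cells of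
  that parity it has one blue and one green side. In every cell, the blue (and likewise the green)
  connections among split corners are the same before and after the half-step, so paths and
  cycles through split vertices persist. A cycle avoiding split vertices runs around a single
  monochrome cell, and such a cycle merely changes color. In a boundary cell the two endpoints
  exchange colors, so every path end moves to the neighboring endpoint: blue ends clockwise and
  green ends counterclockwise for odd cells, and again in the same directions for even cells,
  because the boundary colors have been swapped in between.\<close>

section \<open>Paths and cycles in graphs of maximum degree two\<close>

text \<open>Every edge is a side of exactly one cell of each parity, so a half-step acts on disjoint
  blocks of edges. The four edges at an interior vertex fall into two pairs, one for each of its two
  cells of that parity. With two blue and two green edges, either both pairs are mixed (a split
  vertex) or both are monochromatic, of opposite colors. In the second case all edges of one color
  lie in one cell, so a path of that color can pass to another cell only at a split vertex, and
  comparing single cells is enough. The half-step is the local move that swaps the colors around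
  each alternating cell, followed by an exchange of the two colors on all edges. Because of this
  exchange, blue connections correspond to blue ones: an alternating cell stays as it is, and in any
  other cell the blue and the green connections among split corners agree, at the rim once the two
  endpoints of the cell are identified. Two exchanges cancel, so a pair of half-steps restores the
  prescribed boundary colors.\<close>

definition adjacency :: "'a set set \<Rightarrow> 'a rel" where
  "adjacency E = {(u, v). {u, v} \<in> E}"

lemma adjacency_iff [simp]: "(u, v) \<in> adjacency E \<longleftrightarrow> {u, v} \<in> E"
  by (simp add: adjacency_def)

lemma sym_adjacency: "sym (adjacency E)"
  by (auto intro!: symI simp: insert_commute)

lemma path_imp_rtrancl:
  assumes "is_path E vs"
  shows "(hd vs, last vs) \<in> (adjacency E)\<^sup>*"
proof -
  have "vs \<noteq> [] \<Longrightarrow> successively (\<lambda>u v. {u, v} \<in> E) vs \<Longrightarrow> (hd vs, last vs) \<in> (adjacency E)\<^sup>*"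
  proof (induction vs)
    case (Cons a vs)
    then show ?case
      by (cases vs) (auto intro: converse_rtrancl_into_rtrancl)
  qed simp
  then show ?thesis using assms by (simp add: is_path_def)
qed

lemma rtrancl_imp_path:
  assumes "(u, v) \<in> (adjacency E)\<^sup>*"
  shows "\<exists>vs. is_path E vs \<and> hd vs = u \<and> last vs = v"
  using assms
proof (induction rule: rtrancl_induct)
  case base
  show ?case by (rule exI[of _ "[u]"]) (simp add: is_path_def)
next
  case (step y z)
  then obtain vs where vs: "is_path E vs" "hd vs = u" "last vs = y" by blast
  show ?case
  \<comment> \<open>If the walk returns to a vertex of the path, the prefix ending there is already
    a simple path to it.\<close>
  proof (cases "z \<in> set vs")
    case True
    then obtain ys zs where "vs = ys @ z # zs" by (meson split_list)
    then have "is_path E (ys @ [z])" "hd (ys @ [z]) = u"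
      using vs by (auto simp: is_path_def successively_append_iff hd_append)
    then show ?thesis by (intro exI[of _ "ys @ [z]"]) simp
  next
    case False
    then have "is_path E (vs @ [z])" "hd (vs @ [z]) = u"
      using vs step.hyps(2) by (auto simp: is_path_def successively_append_iff)
    then show ?thesis by (intro exI[of _ "vs @ [z]"]) simp
  qed
qed

text \<open>Pairings depend on reachability only. Closures of relations, unlike vertex lists, can be
  glued from pieces inside single cells.\<close>

lemma ex_path_iff_rtrancl:
  "(\<exists>vs. is_path E vs \<and> hd vs = u \<and> last vs = v) \<longleftrightarrow> (u, v) \<in> (adjacency E)\<^sup>*"
  using path_imp_rtrancl rtrancl_imp_path by metis

lemma closed_edges_nth:
  "closed_edges vs = (\<lambda>i. {vs ! i, vs ! (Suc i mod length vs)}) ` {..<length vs}"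
  by (force simp: closed_edges_def set_zip nth_rotate1 image_iff)

lemma Union_closed_edges: "\<Union> (closed_edges vs) = set vs"
proof -
  have "Suc i mod length vs < length vs" if "i < length vs" for i
    using that by (intro mod_less_divisor) auto
  then show ?thesis
    unfolding closed_edges_nth by (fastforce simp: in_set_conv_nth)
qed

lemma pred_mod: "i < m \<Longrightarrow> Suc ((i + m - 1) mod m) mod m = (i::nat)"
proof -
  assume i: "i < m"
  have "(i + m - 1) mod m = (if i = 0 then m - 1 else i - 1)"
  proof (cases i)
    case (Suc j)
    then have "i + m - 1 = j + m" by simp
    then show ?thesis using i Suc by simp
  qed (use i in simp)
  then show ?thesis using i by simp
qed

text \<open>Length at least 3 separates successor and predecessor, so a vertex of a cycle has two
  distinct neighbors on it. The predecessor index adds the length before subtracting 1, which avoids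
  truncated subtraction at 0.\<close>

lemma nth_cyclic_neighbours:
  assumes "distinct vs" "3 \<le> length vs" "i < length vs"
  shows "vs ! (Suc i mod length vs) \<noteq> vs ! ((i + length vs - 1) mod length vs)"
proof -
  have "Suc i mod length vs \<noteq> (i + length vs - 1) mod length vs"
  proof -
    have "(i + length vs - 1) mod length vs = (if i = 0 then length vs - 1 else i - 1)"
    proof (cases i)
      case (Suc j)
      then have "i + length vs - 1 = j + length vs" by simp
      then show ?thesis using assms(3) Suc by simp
    qed (use assms(3) in simp)
    then show ?thesis using assms(2,3) by (cases "Suc i = length vs") auto
  qed
  moreover have "Suc i mod length vs < length vs" "(i + length vs - 1) mod length vs < length vs"
    using mod_less_divisor[of "length vs"] assms(2) by (metis gr0I not_numeral_le_zero)+
  ultimately show ?thesis using assms(1) by (simp add: nth_eq_iff_index_eq)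
qed

lemma rtrancl_Image_subset:
  assumes "v \<in> A" "r `` A \<subseteq> A"
  shows "r\<^sup>* `` {v} \<subseteq> A"
proof
  fix w assume "w \<in> r\<^sup>* `` {v}"
  then have "(v, w) \<in> r\<^sup>*" by simp
  then show "w \<in> A" by induction (use assms in auto)
qed

lemma sym_rtrancl_Image_eq:
  assumes "sym r" "(v, w) \<in> r\<^sup>*"
  shows "r\<^sup>* `` {v} = r\<^sup>* `` {w}"
proof -
  have "(w, v) \<in> r\<^sup>*" using assms by (metis sym_rtrancl symD)
  then show ?thesis using assms(2) by (auto intro: rtrancl_trans)
qed

locale degree_two_graph =
  fixes E :: "'a set set"
  assumes finite_E: "finite E"
    and card_edge: "e \<in> E \<Longrightarrow> card e = 2"
    and degree_le: "card {e \<in> E. v \<in> e} \<le> 2"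
begin

definition full :: "'a set" where
  "full = {v. card {e \<in> E. v \<in> e} = 2}"

lemma no_loop: "{v} \<notin> E"
  using card_edge[of "{v}"] by auto

lemma card_neighbours: "card {w. {v, w} \<in> E} = card {e \<in> E. v \<in> e}"
proof (rule bij_betw_same_card)
  show "bij_betw (\<lambda>w. {v, w}) {w. {v, w} \<in> E} {e \<in> E. v \<in> e}"
    unfolding bij_betw_def
  proof
    show "inj_on (\<lambda>w. {v, w}) {w. {v, w} \<in> E}"
      by (auto simp: inj_on_def doubleton_eq_iff)
    show "(\<lambda>w. {v, w}) ` {w. {v, w} \<in> E} = {e \<in> E. v \<in> e}"
    proof safe
      fix e assume e: "e \<in> E" "v \<in> e"
      then obtain a b where "e = {a, b}" using card_edge card_2_iff by metis
      with e show "e \<in> (\<lambda>w. {v, w}) ` {w. {v, w} \<in> E}" by (auto simp: insert_commute)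
    qed
  qed
qed

lemma finite_neighbours: "finite {w. {v, w} \<in> E}"
proof -
  have "finite (\<Union> E)"
    using finite_E card_edge by (metis card.infinite finite_Union zero_neq_numeral)
  then show ?thesis by (rule rev_finite_subset) auto
qed

lemma neighbours_eq:
  assumes "{v, a} \<in> E" "{v, b} \<in> E" "a \<noteq> b"
  shows "{w. {v, w} \<in> E} = {a, b}" "v \<in> full"
proof -
  have sub: "{a, b} \<subseteq> {w. {v, w} \<in> E}" using assms by auto
  have le: "card {w. {v, w} \<in> E} \<le> card {a, b}"
    using degree_le[of v] card_neighbours[of v] assms(3) by simp
  show eq: "{w. {v, w} \<in> E} = {a, b}"
    using card_seteq[OF finite_neighbours sub le] by simp
  show "v \<in> full"
    using eq assms(3) card_neighbours[of v] by (simp add: full_def)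
qed

text \<open>A vertex of a cycle spends both of its edges on the cycle, so no edge leaves the cycle
  and none is a chord. Hence the vertex set is a whole component, and the cycle can be recovered
  from it.\<close>

lemma cycle_component:
  assumes vs: "distinct vs" "3 \<le> length vs" "closed_edges vs \<subseteq> E"
  shows "set vs \<subseteq> full"
    and "v \<in> set vs \<Longrightarrow> (adjacency E)\<^sup>* `` {v} = set vs"
    and "closed_edges vs = {e \<in> E. e \<subseteq> set vs}"
proof -
  let ?m = "length vs"
  have m: "0 < ?m" using vs by auto
  have step: "{vs ! i, vs ! (Suc i mod ?m)} \<in> closed_edges vs" if "i < ?m" for i
    using that by (auto simp: closed_edges_nth)
  have pred: "{vs ! i, vs ! ((i + ?m - 1) mod ?m)} \<in> closed_edges vs" if "i < ?m" for i
    using step[of "(i + ?m - 1) mod ?m"] that m pred_mod[OF that] by (simp add: insert_commute)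
  have nb: "{w. {vs ! i, w} \<in> E} = {vs ! (Suc i mod ?m), vs ! ((i + ?m - 1) mod ?m)}"
    "vs ! i \<in> full" if "i < ?m" for i
    using neighbours_eq[OF _ _ nth_cyclic_neighbours[OF vs(1,2) that]] step[OF that] pred[OF that] vs(3)
    by blast+
  show full: "set vs \<subseteq> full" using nb(2) by (auto simp: in_set_conv_nth)
  have edge_in: "{x, y} \<in> closed_edges vs" if xy: "{x, y} \<in> E" "x \<in> set vs" for x y
  proof -
    obtain i where i: "i < ?m" "x = vs ! i" using xy(2) by (auto simp: in_set_conv_nth)
    then have "y \<in> {vs ! (Suc i mod ?m), vs ! ((i + ?m - 1) mod ?m)}"
      using nb(1)[OF i(1)] xy(1) by auto
    then show ?thesis using step pred i by auto
  qed
  show "closed_edges vs = {e \<in> E. e \<subseteq> set vs}"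
  proof (intro equalityI subsetI)
    fix e assume "e \<in> closed_edges vs"
    then show "e \<in> {e \<in> E. e \<subseteq> set vs}" using vs(3) Union_closed_edges[of vs] by auto
  next
    fix e assume e: "e \<in> {e \<in> E. e \<subseteq> set vs}"
    then obtain a b where "e = {a, b}" using card_edge card_2_iff by (metis (no_types, lifting) mem_Collect_eq)
    then show "e \<in> closed_edges vs" using e edge_in by auto
  qed
  have "adjacency E `` set vs \<subseteq> set vs"
    using edge_in Union_closed_edges[of vs] by fastforce
  then have sub: "(adjacency E)\<^sup>* `` {v} \<subseteq> set vs" if "v \<in> set vs" for v
    using rtrancl_Image_subset that by metis
  have from0: "(vs ! 0, vs ! i) \<in> (adjacency E)\<^sup>*" if "i < ?m" for i
    using that
  proof (induction i)
    case (Suc i)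
    have "{vs ! i, vs ! Suc i} \<in> E" using step[of i] Suc.prems vs(3) by auto
    then show ?case using Suc by (meson Suc_lessD adjacency_iff rtrancl.rtrancl_into_rtrancl)
  qed simp
  have all: "(adjacency E)\<^sup>* `` {vs ! 0} = set vs"
    using sub[of "vs ! 0"] m from0 by (force simp: in_set_conv_nth)
  show "(adjacency E)\<^sup>* `` {v} = set vs" if "v \<in> set vs"
    using sym_rtrancl_Image_eq[OF sym_adjacency, of "vs ! 0" v E] all that by auto
qed

text \<open>Take a longest path in the component. By maximality both neighbors of its last vertex
  lie on it, and the degree bound forces one of them to be the first vertex, which closes the
  path.\<close>

lemma component_is_cycle:
  assumes "v \<in> full" "(adjacency E)\<^sup>* `` {v} \<subseteq> full"
  shows "\<exists>C \<in> cycles E. \<Union> C = (adjacency E)\<^sup>* `` {v}"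
proof -
  define K where "K = (adjacency E)\<^sup>* `` {v}"
  have nbK: "w \<in> K" if "u \<in> K" "{u, w} \<in> E" for u w
    using that unfolding K_def by (auto intro: rtrancl_into_rtrancl)
  have "full \<subseteq> \<Union> E"
  proof
    fix x assume "x \<in> full"
    then have "{e \<in> E. x \<in> e} \<noteq> {}" by (metis (mono_tags) card.empty full_def mem_Collect_eq zero_neq_numeral)
    then show "x \<in> \<Union> E" by auto
  qed
  then have "finite K"
    using assms(2) finite_E card_edge unfolding K_def
    by (metis card.infinite finite_Union finite_subset zero_neq_numeral)
  define P where "P vs \<longleftrightarrow> is_path E vs \<and> set vs \<subseteq> K" for vs
  have "P [v]" by (simp add: P_def is_path_def K_def)
  moreover have "length vs < Suc (card K)" if "P vs" for vs
    using that \<open>finite K\<close> by (metis P_def card_mono distinct_card is_path_def le_imp_less_Suc)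
  ultimately obtain vs where vs: "P vs" and max: "\<And>us. P us \<Longrightarrow> length us \<le> length vs"
    using ex_has_greatest_nat[of P "[v]" length "Suc (card K)"] by blast
  let ?m = "length vs"
  let ?z = "last vs"
  have ne: "vs \<noteq> []" and d: "distinct vs" and sv: "successively (\<lambda>u v. {u, v} \<in> E) vs"
    and K: "set vs \<subseteq> K" using vs by (auto simp: P_def is_path_def)
  have zK: "?z \<in> K" using K ne by auto
  have z: "?z = vs ! (?m - 1)" using ne by (simp add: last_conv_nth)
  have in_vs: "w \<in> set vs" if "{?z, w} \<in> E" for w
  proof (rule ccontr)
    assume "w \<notin> set vs"
    then have "P (vs @ [w])" using vs that nbK[OF zK that]
      by (auto simp: P_def is_path_def successively_append_iff)
    then show False using max by force
  qed
  have "card {w. {?z, w} \<in> E} = 2"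
    using zK assms(2) card_neighbours[of ?z] by (auto simp: K_def full_def)
  then obtain p q where pq: "{w. {?z, w} \<in> E} = {p, q}" "p \<noteq> q" by (auto simp: card_2_iff)
  have "\<exists>i. i < ?m - 1 \<and> w = vs ! i" if w: "{?z, w} \<in> E" for w
  proof -
    obtain i where i: "i < ?m" "w = vs ! i" using in_vs[OF w] by (auto simp: in_set_conv_nth)
    have "w \<noteq> ?z" using no_loop w by auto
    then have "i \<noteq> ?m - 1" using z i(2) by auto
    then show ?thesis using i by (intro exI[of _ i]) auto
  qed
  moreover have "{?z, p} \<in> E" "{?z, q} \<in> E" using pq(1) by blast+
  ultimately obtain i j where ij: "i < ?m - 1" "p = vs ! i" "j < ?m - 1" "q = vs ! j" by blast
  then have "i \<noteq> j" using pq(2) by auto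
  then obtain a b where ab: "a < b" "b < ?m - 1" "{?z, vs ! a} \<in> E" "{?z, vs ! b} \<in> E"
    using ij \<open>{?z, p} \<in> E\<close> \<open>{?z, q} \<in> E\<close> by (cases "i < j") (simp, metis nat_neq_iff)+
  have suc: "{vs ! i, vs ! Suc i} \<in> E" if "Suc i < ?m" for i
    using sv that by (simp add: successively_conv_nth)
  \<comment> \<open>From \<open>a < b\<close> and \<open>b < ?m - 1\<close>, the vertex
    \<open>vs ! Suc a\<close> is not the last one. So \<open>a > 0\<close> would give
    \<open>vs ! a\<close> three neighbors: its two path neighbors and the last vertex.\<close>
  have "a = 0"
  proof (rule ccontr)
    assume "a \<noteq> 0"
    then have "{vs ! a, vs ! (a - 1)} \<in> E" "{vs ! a, vs ! Suc a} \<in> E"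
      using suc[of "a - 1"] suc[of a] ab by (auto simp: insert_commute)
    moreover have "{vs ! a, ?z} \<in> E" using ab by (simp add: insert_commute)
    moreover have "vs ! (a - 1) \<noteq> vs ! Suc a" "?z \<noteq> vs ! (a - 1)" "?z \<noteq> vs ! Suc a"
      using d z ab by (auto simp: nth_eq_iff_index_eq)
    ultimately show False using neighbours_eq(1)[of "vs ! a" "vs ! (a - 1)" "vs ! Suc a"] by auto
  qed
  have "closed_edges vs \<subseteq> E"
  proof
    fix e assume "e \<in> closed_edges vs"
    then obtain i where i: "i < ?m" "e = {vs ! i, vs ! (Suc i mod ?m)}" by (auto simp: closed_edges_nth)
    show "e \<in> E"
    proof (cases "Suc i = ?m")
      case True
      then have "vs ! i = ?z" using z by (metis diff_Suc_1)
      then show ?thesis using i True ab \<open>a = 0\<close> by simp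
    next
      case False
      then show ?thesis using i suc by auto
    qed
  qed
  moreover have "3 \<le> ?m" using ab by simp
  ultimately have "closed_edges vs \<in> cycles E" and "(adjacency E)\<^sup>* `` {hd vs} = set vs"
    using d cycle_component(2)[OF d] ne by (auto simp: cycles_def)
  moreover have "(adjacency E)\<^sup>* `` {v} = (adjacency E)\<^sup>* `` {hd vs}"
    using K hd_in_set[OF ne] by (intro sym_rtrancl_Image_eq sym_adjacency) (auto simp: K_def)
  ultimately show ?thesis using Union_closed_edges by metis
qed

text \<open>Taking the union of its edges turns a cycle into a component in which every degree is
  two. Components, unlike cycles, can be transported through statements about connectivity.\<close>

lemma card_cycles:
  "card (cycles E) = card {K. \<exists>v \<in> full. K = (adjacency E)\<^sup>* `` {v} \<and> K \<subseteq> full}"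
proof (rule bij_betw_same_card)
  show "bij_betw \<Union> (cycles E) {K. \<exists>v \<in> full. K = (adjacency E)\<^sup>* `` {v} \<and> K \<subseteq> full}"
    unfolding bij_betw_def
  proof
    show "inj_on \<Union> (cycles E)"
    proof (rule inj_onI)
      fix C C' assume "C \<in> cycles E" "C' \<in> cycles E" and eq: "\<Union> C = \<Union> C'"
      then obtain vs vs' where "distinct vs" "3 \<le> length vs" "C \<subseteq> E" and C: "C = closed_edges vs"
        and "distinct vs'" "3 \<le> length vs'" "C' \<subseteq> E" and C': "C' = closed_edges vs'"
        by (auto simp: cycles_def)
      then show "C = C'" using cycle_component(3)[of vs] cycle_component(3)[of vs']
          eq[unfolded C C' Union_closed_edges]
        by simp
    qed
    show "\<Union> ` cycles E = {K. \<exists>v \<in> full. K = (adjacency E)\<^sup>* `` {v} \<and> K \<subseteq> full}"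
    proof (intro equalityI subsetI)
      fix K assume "K \<in> \<Union> ` cycles E"
      then obtain vs where vs: "distinct vs" "3 \<le> length vs" "closed_edges vs \<subseteq> E" "K = set vs"
        by (auto simp: cycles_def Union_closed_edges)
      then have "hd vs \<in> set vs" by (intro hd_in_set) auto
      then show "K \<in> {K. \<exists>v \<in> full. K = (adjacency E)\<^sup>* `` {v} \<and> K \<subseteq> full}"
        using cycle_component(1,2)[OF vs(1-3)] vs(4) by blast
    next
      fix K assume "K \<in> {K. \<exists>v \<in> full. K = (adjacency E)\<^sup>* `` {v} \<and> K \<subseteq> full}"
      then obtain v where v: "v \<in> full" "K = (adjacency E)\<^sup>* `` {v}" "K \<subseteq> full" by blast
      then show "K \<in> \<Union> ` cycles E" using component_is_cycle[OF v(1)] by auto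
    qed
  qed
qed

end

text \<open>A path between points of \<open>F\<close> can leave a cell only at a point of \<open>F\<close>, so only the
  connections between points of \<open>F\<close> inside single cells matter.\<close>

lemma rtrancl_UN_contract:
  fixes r :: "'d \<Rightarrow> 'v rel"
  assumes sym: "\<And>d. d \<in> D \<Longrightarrow> sym (r d)"
    and own_cell: "\<And>z d d'. z \<notin> F \<Longrightarrow> d \<in> D \<Longrightarrow> d' \<in> D \<Longrightarrow>
      z \<in> Domain (r d) \<Longrightarrow> z \<in> Domain (r d') \<Longrightarrow> d = d'"
    and "x \<in> F" "y \<in> F"
  shows "(x, y) \<in> (\<Union>d \<in> D. r d)\<^sup>* \<longleftrightarrow> (x, y) \<in> (\<Union>d \<in> D. (r d)\<^sup>* \<inter> F \<times> F)\<^sup>*"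
    (is "_ \<longleftrightarrow> _ \<in> ?S\<^sup>*")
proof
  assume "(x, y) \<in> (\<Union>d \<in> D. r d)\<^sup>*"
  \<comment> \<open>While the path is off \<open>F\<close>, the invariant remembers the last point
    \<open>w\<close> of \<open>F\<close> and the cell \<open>d\<close> traversed since then.
    \<open>own_cell\<close> keeps the next step in the same \<open>d\<close>.\<close>
  then have "(y \<in> F \<longrightarrow> (x, y) \<in> ?S\<^sup>*) \<and>
    (y \<notin> F \<longrightarrow> (\<exists>w d. w \<in> F \<and> d \<in> D \<and> (x, w) \<in> ?S\<^sup>* \<and> (w, y) \<in> (r d)\<^sup>* \<and> y \<in> Domain (r d)))"
  proof (induction rule: rtrancl_induct)
    case base
    then show ?case using \<open>x \<in> F\<close> by simp
  next
    case (step y z)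
    from step.hyps(2) obtain d where d: "d \<in> D" "(y, z) \<in> r d" by blast
    then have zd: "z \<in> Domain (r d)" using sym by (meson DomainI symD)
    obtain w where w: "w \<in> F" "(x, w) \<in> ?S\<^sup>*" "(w, y) \<in> (r d)\<^sup>*"
    proof (cases "y \<in> F")
      case True
      then show ?thesis using step.IH that by blast
    next
      case False
      then show ?thesis using step.IH that own_cell[OF False] d by blast
    qed
    then have wz: "(w, z) \<in> (r d)\<^sup>*" using d(2) by simp
    show ?case
    proof (cases "z \<in> F")
      case True
      then have "(w, z) \<in> ?S" using wz w(1) d(1) by blast
      then show ?thesis using w(2) True by (meson rtrancl.rtrancl_into_rtrancl)
    next
      case False
      then show ?thesis using w(1,2) wz d(1) zd by blast
    qed
  qed
  then show "(x, y) \<in> ?S\<^sup>*" using \<open>y \<in> F\<close> by simp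
next
  have "?S \<subseteq> (\<Union>d \<in> D. r d)\<^sup>*"
  proof -
    have "(r d)\<^sup>* \<subseteq> (\<Union>d \<in> D. r d)\<^sup>*" if "d \<in> D" for d
      using that by (intro rtrancl_mono) auto
    then show ?thesis by blast
  qed
  then have "?S\<^sup>* \<subseteq> (\<Union>d \<in> D. r d)\<^sup>*" by (rule rtrancl_subset_rtrancl)
  then show "(x, y) \<in> ?S\<^sup>* \<Longrightarrow> (x, y) \<in> (\<Union>d \<in> D. r d)\<^sup>*" by blast
qed

section \<open>Cells and the half-step of the gyration\<close>

fun flip :: "color \<Rightarrow> color" where
  "flip Blue = Green" |
  "flip Green = Blue"

lemma flip_flip [simp]: "flip (flip k) = k"
  by (cases k) auto

lemma flip_eq_iff [simp]: "flip k = l \<longleftrightarrow> k \<noteq> l"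
  by (cases k; cases l) auto

lemma eq_flip_iff [simp]: "k = flip l \<longleftrightarrow> k \<noteq> l"
  by (cases k; cases l) auto

text \<open>Naming an edge by its left or lower end turns equality and incidence of edges into
  linear arithmetic.\<close>

definition hedge :: "int \<Rightarrow> int \<Rightarrow> vertex set" where
  "hedge x y = {(x, y), (x + 1, y)}"

definition vedge :: "int \<Rightarrow> int \<Rightarrow> vertex set" where
  "vedge x y = {(x, y), (x, y + 1)}"

lemma edge_eq_iffs [simp]:
  "hedge x y = hedge x' y' \<longleftrightarrow> x = x' \<and> y = y'"
  "vedge x y = vedge x' y' \<longleftrightarrow> x = x' \<and> y = y'"
  "hedge x y \<noteq> vedge x' y'"
  "vedge x y \<noteq> hedge x' y'"
  by (auto simp: hedge_def vedge_def doubleton_eq_iff)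

lemma in_edge_iffs [simp]:
  "(a, b) \<in> hedge x y \<longleftrightarrow> b = y \<and> (a = x \<or> a = x + 1)"
  "(a, b) \<in> vedge x y \<longleftrightarrow> a = x \<and> (b = y \<or> b = y + 1)"
  by (auto simp: hedge_def vedge_def)

lemma interior_iff [simp]:
  "(x, y) \<in> interior_vertices n \<longleftrightarrow> 1 \<le> x \<and> x \<le> int n \<and> 1 \<le> y \<and> y \<le> int n"
  by (auto simp: interior_vertices_def)

lemma endpoints_iff [simp]:
  "(x, y) \<in> endpoints n \<longleftrightarrow>
    (x = 0 \<or> x = int n + 1) \<and> 1 \<le> y \<and> y \<le> int n \<or>
    (y = 0 \<or> y = int n + 1) \<and> 1 \<le> x \<and> x \<le> int n"
  by (auto simp: endpoints_def)

lemma grid_adjacent_cases: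
  assumes "grid_adjacent (x, y) v"
  shows "{(x, y), v} \<in> {hedge x y, hedge (x - 1) y, vedge x y, vedge x (y - 1)}"
proof -
  obtain a b where v: "v = (a, b)" by (cases v)
  from assms have "(a = x \<and> (b = y + 1 \<or> b = y - 1)) \<or> (b = y \<and> (a = x + 1 \<or> a = x - 1))"
    unfolding v by simp arith
  then show ?thesis unfolding v by (auto simp: hedge_def vedge_def)
qed

lemma edgesE:
  assumes "e \<in> edges n"
  obtains x y where "e = hedge x y" "0 \<le> x" "x \<le> int n" "1 \<le> y" "y \<le> int n"
    | x y where "e = vedge x y" "1 \<le> x" "x \<le> int n" "0 \<le> y" "y \<le> int n"
proof -
  from assms obtain x y v where e: "e = {(x, y), v}" "(x, y) \<in> interior_vertices n" "grid_adjacent (x, y) v"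
    by (auto simp: edges_def)
  from grid_adjacent_cases[OF e(3)] e(2) show ?thesis
    unfolding e(1)[symmetric]
    by (elim insertE; (elim that; simp)?)  auto
qed

lemma edges_iffs [simp]:
  "hedge x y \<in> edges n \<longleftrightarrow> 0 \<le> x \<and> x \<le> int n \<and> 1 \<le> y \<and> y \<le> int n"
  "vedge x y \<in> edges n \<longleftrightarrow> 1 \<le> x \<and> x \<le> int n \<and> 0 \<le> y \<and> y \<le> int n"
proof -
  have in_edges: "{u, v} \<in> edges n" if "grid_adjacent u v" "u \<in> interior_vertices n \<or> v \<in> interior_vertices n" for u v
  proof -
    have "grid_adjacent v u" using that(1) by (cases u; cases v) (auto simp: abs_minus_commute)
    moreover have "{u, v} = {v, u}" by auto
    ultimately show ?thesis using that unfolding edges_def mem_Collect_eq by blast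
  qed
  show "hedge x y \<in> edges n \<longleftrightarrow> 0 \<le> x \<and> x \<le> int n \<and> 1 \<le> y \<and> y \<le> int n"
  proof
    assume "hedge x y \<in> edges n"
    then show "0 \<le> x \<and> x \<le> int n \<and> 1 \<le> y \<and> y \<le> int n" by (rule edgesE) auto
  next
    assume "0 \<le> x \<and> x \<le> int n \<and> 1 \<le> y \<and> y \<le> int n"
    then show "hedge x y \<in> edges n" unfolding hedge_def by (intro in_edges) auto
  qed
  show "vedge x y \<in> edges n \<longleftrightarrow> 1 \<le> x \<and> x \<le> int n \<and> 0 \<le> y \<and> y \<le> int n"
  proof
    assume "vedge x y \<in> edges n"
    then show "1 \<le> x \<and> x \<le> int n \<and> 0 \<le> y \<and> y \<le> int n" by (rule edgesE) auto
  next
    assume "1 \<le> x \<and> x \<le> int n \<and> 0 \<le> y \<and> y \<le> int n"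
    then show "vedge x y \<in> edges n" unfolding vedge_def by (intro in_edges) auto
  qed
qed

lemma edge_vertices:
  assumes "e \<in> edges n" "v \<in> e"
  shows "v \<in> interior_vertices n \<union> endpoints n"
  using assms(1) by (rule edgesE) (use assms(2) in \<open>cases v; auto\<close>)+

lemma card_edge:
  assumes "e \<in> edges n"
  shows "card e = 2"
  using assms by (rule edgesE) (auto simp: hedge_def vedge_def)

lemma finite_vertices: "finite (interior_vertices n)" "finite (endpoints n)"
  by (simp_all add: interior_vertices_def endpoints_def)

lemma finite_edges: "finite (edges n)"
proof (rule finite_subset)
  show "edges n \<subseteq> Pow (interior_vertices n \<union> endpoints n)" using edge_vertices by blast
qed (simp add: finite_vertices)

lemma edges_at_interior:
  assumes "(x, y) \<in> interior_vertices n"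
  shows "{e \<in> edges n. (x, y) \<in> e} = {hedge x y, hedge (x - 1) y, vedge x y, vedge x (y - 1)}"
proof (intro equalityI subsetI)
  fix e assume "e \<in> {e \<in> edges n. (x, y) \<in> e}"
  then have "e \<in> edges n" "(x, y) \<in> e" by auto
  then show "e \<in> {hedge x y, hedge (x - 1) y, vedge x y, vedge x (y - 1)}"
    by (elim edgesE) auto
qed (use assms in auto)

lemma edge_at_endpoint_unique:
  assumes "v \<in> endpoints n" "e \<in> edges n" "e' \<in> edges n" "v \<in> e" "v \<in> e'"
  shows "e = e'"
  using assms(2)
proof (rule edgesE)
  fix x y assume "e = hedge x y" "0 \<le> x" "x \<le> int n" "1 \<le> y" "y \<le> int n"
  with assms(3) show ?thesis by (elim edgesE) (use assms(1,4,5) in \<open>cases v; auto\<close>)+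
next
  fix x y assume "e = vedge x y" "1 \<le> x" "x \<le> int n" "0 \<le> y" "y \<le> int n"
  with assms(3) show ?thesis by (elim edgesE) (use assms(1,4,5) in \<open>cases v; auto\<close>)+
qed

section \<open>Unit cells, their sides and corners\<close>

fun sides :: "vertex \<Rightarrow> vertex set set" where
  "sides (i, j) = {hedge i j, hedge i (j + 1), vedge i j, vedge (i + 1) j}"

fun corners :: "vertex \<Rightarrow> vertex set" where
  "corners (i, j) = {i, i + 1} \<times> {j, j + 1}"

text \<open>A cell is named by its lower left corner. Indices 0 and \<open>int n\<close> give the
  rim cells, which have sides outside the graph; with them every end edge, too, lies in a cell of
  each parity.\<close>

definition cells :: "nat \<Rightarrow> bool \<Rightarrow> vertex set" where
  "cells n p = {(i, j). 0 \<le> i \<and> i \<le> int n \<and> 0 \<le> j \<and> j \<le> int n \<and> (even (i + j) \<longleftrightarrow> p)}"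

lemma cells_iff [simp]:
  "(i, j) \<in> cells n p \<longleftrightarrow> 0 \<le> i \<and> i \<le> int n \<and> 0 \<le> j \<and> j \<le> int n \<and> (even (i + j) \<longleftrightarrow> p)"
  by (simp add: cells_def)

text \<open>Since all four sides must be edges, a rim cell never alternates, so a half-step flips
  every end edge.\<close>

fun alternating :: "nat \<Rightarrow> (vertex set \<Rightarrow> color) \<Rightarrow> vertex \<Rightarrow> bool" where
  "alternating n c (i, j) \<longleftrightarrow> sides (i, j) \<subseteq> edges n \<and>
     c (hedge i j) = c (hedge i (j + 1)) \<and> c (vedge i j) = c (vedge (i + 1) j) \<and>
     c (hedge i j) \<noteq> c (vedge i j)"

lemma alternating_sides: "alternating n c D \<Longrightarrow> sides D \<subseteq> edges n"
  by (cases D) (simp only: alternating.simps)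

lemma side_subset_corners: "e \<in> sides D \<Longrightarrow> e \<subseteq> corners D"
  by (cases D) (auto simp: hedge_def vedge_def)

text \<open>Two different cells with a common side are neighbors and have opposite parity.\<close>

lemma side_cell_unique:
  assumes "D \<in> cells n p" "D' \<in> cells n p" "e \<in> sides D" "e \<in> sides D'"
  shows "D = D'"
proof -
  obtain i j i' j' where D: "D = (i, j)" "D' = (i', j')" by (cases D; cases D') auto
  have "\<not> (i = i' + 1 \<and> j = j')" "\<not> (i' = i + 1 \<and> j = j')" "\<not> (i = i' \<and> j = j' + 1)"
    "\<not> (i = i' \<and> j' = j + 1)" using assms(1,2) unfolding D by auto
  then show ?thesis using assms(3,4) unfolding D by (auto 0 0)
qed

lemma ex_cell_side:
  assumes "e \<in> edges n"
  shows "\<exists>D \<in> cells n p. e \<in> sides D"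
  using assms
proof (rule edgesE)
  fix x y assume e: "e = hedge x y" "0 \<le> x" "x \<le> int n" "1 \<le> y" "y \<le> int n"
  show ?thesis
    by (rule bexI[of _ "if even (x + y) = p then (x, y) else (x, y - 1)"]) (use e in auto)
next
  fix x y assume e: "e = vedge x y" "1 \<le> x" "x \<le> int n" "0 \<le> y" "y \<le> int n"
  show ?thesis
    by (rule bexI[of _ "if even (x + y) = p then (x, y) else (x - 1, y)"]) (use e in auto)
qed

lemma sides_at_corner:
  "{e \<in> sides (x, y). (x, y) \<in> e} = {hedge x y, vedge x y}"
  "{e \<in> sides (x - 1, y). (x, y) \<in> e} = {hedge (x - 1) y, vedge x y}"
  "{e \<in> sides (x, y - 1). (x, y) \<in> e} = {hedge x y, vedge x (y - 1)}"
  "{e \<in> sides (x - 1, y - 1). (x, y) \<in> e} = {hedge (x - 1) y, vedge x (y - 1)}"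
  by auto

text \<open>Of the four cells around an interior vertex, the two of one parity are diagonally
  opposite. They share no side, so they divide the four edges at the vertex into two pairs. The
  local arguments at vertices rest on this division.\<close>

lemma corner_split:
  assumes v: "v \<in> interior_vertices n" and D: "D \<in> cells n p" "v \<in> corners D"
  obtains D' e1 e2 e3 e4 where "D' \<in> cells n p" "D' \<noteq> D" "distinct [e1, e2, e3, e4]"
    "{e \<in> edges n. v \<in> e} = {e1, e2, e3, e4}"
    "{e \<in> sides D. v \<in> e} = {e1, e2}" "{e \<in> sides D'. v \<in> e} = {e3, e4}"
    "\<forall>D'' \<in> cells n p. v \<in> corners D'' \<longrightarrow> D'' = D \<or> D'' = D'"
proof -
  obtain x y where xy: "v = (x, y)" by (cases v)
  note edges = edges_at_interior[OF v[unfolded xy]]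
  have cells_at: "C \<in> {(x, y), (x - 1, y), (x, y - 1), (x - 1, y - 1)}" if "v \<in> corners C" for C
    using that unfolding xy by (cases C) auto
  have even_shift: "even (x - 1 + y) \<longleftrightarrow> odd (x + y)" "even (x + (y - 1)) \<longleftrightarrow> odd (x + y)"
    "even (x - 1 + (y - 1)) \<longleftrightarrow> even (x + y)" by auto
  consider "D = (x, y)" | "D = (x - 1, y)" | "D = (x, y - 1)" | "D = (x - 1, y - 1)"
    using cells_at[OF D(2)] by auto
  then show ?thesis
  proof cases
    case 1
    show ?thesis
      by (rule that[of "(x - 1, y - 1)" "hedge x y" "vedge x y" "hedge (x - 1) y" "vedge x (y - 1)"])
        (use v D(1) 1 cells_at edges sides_at_corner[of x y] even_shift in \<open>auto simp: xy\<close>)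
  next
    case 2
    show ?thesis
      by (rule that[of "(x, y - 1)" "hedge (x - 1) y" "vedge x y" "hedge x y" "vedge x (y - 1)"])
        (use v D(1) 2 cells_at edges sides_at_corner[of x y] even_shift in \<open>auto simp: xy\<close>)
  next
    case 3
    show ?thesis
      by (rule that[of "(x - 1, y)" "hedge x y" "vedge x (y - 1)" "hedge (x - 1) y" "vedge x y"])
        (use v D(1) 3 cells_at edges sides_at_corner[of x y] even_shift in \<open>auto simp: xy\<close>)
  next
    case 4
    show ?thesis
      by (rule that[of "(x, y)" "hedge (x - 1) y" "vedge x (y - 1)" "hedge x y" "vedge x y"])
        (use v D(1) 4 cells_at edges sides_at_corner[of x y] even_shift in \<open>auto simp: xy\<close>)
  qed
qed

lemma endpoint_cell_not_full:
  assumes "v \<in> endpoints n" "v \<in> corners D" "D \<in> cells n p"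
  shows "\<not> sides D \<subseteq> edges n"
  using assms by (cases D) auto

section \<open>The half-step on colorings\<close>

definition gyrate :: "nat \<Rightarrow> bool \<Rightarrow> (vertex set \<Rightarrow> color) \<Rightarrow> vertex set \<Rightarrow> color" where
  "gyrate n p c = (\<lambda>e\<in>edges n.
     if \<exists>D \<in> cells n p. e \<in> sides D \<and> alternating n c D then c e else flip (c e))"

lemma gyrate_side:
  assumes "D \<in> cells n p" "e \<in> sides D" "e \<in> edges n"
  shows "gyrate n p c e = (if alternating n c D then c e else flip (c e))"
proof -
  have "(\<exists>D \<in> cells n p. e \<in> sides D \<and> alternating n c D) \<longleftrightarrow> alternating n c D"
    using assms side_cell_unique by blast
  then show ?thesis using assms(3) by (simp add: gyrate_def)
qed

text \<open>Alternation depends only on which sides have equal colors, and the sides of a cell are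
  kept together or flipped together. So a second half-step treats the same cells in the same way and
  undoes the first.\<close>

lemma alternating_gyrate:
  assumes "D \<in> cells n p"
  shows "alternating n (gyrate n p c) D \<longleftrightarrow> alternating n c D"
proof -
  obtain i j where D: "D = (i, j)" by (cases D)
  show ?thesis
  proof (cases "sides D \<subseteq> edges n")
    case True
    define A where "A = alternating n c D"
    have g: "gyrate n p c e = (if A then c e else flip (c e))" if "e \<in> sides D" for e
      using gyrate_side[OF assms that] True that by (auto simp: A_def)
    have "alternating n (gyrate n p c) D \<longleftrightarrow>
      gyrate n p c (hedge i j) = gyrate n p c (hedge i (j + 1)) \<and>
      gyrate n p c (vedge i j) = gyrate n p c (vedge (i + 1) j) \<and>
      gyrate n p c (hedge i j) \<noteq> gyrate n p c (vedge i j)"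
      using True by (simp add: D)
    also have "\<dots> \<longleftrightarrow> c (hedge i j) = c (hedge i (j + 1)) \<and>
      c (vedge i j) = c (vedge (i + 1) j) \<and> c (hedge i j) \<noteq> c (vedge i j)"
      using g[of "hedge i j"] g[of "hedge i (j + 1)"] g[of "vedge i j"] g[of "vedge (i + 1) j"]
      by (cases A; cases "c (hedge i j)"; cases "c (hedge i (j + 1))"; cases "c (vedge i j)"; cases "c (vedge (i + 1) j)")
        (simp_all add: D)
    also have "\<dots> \<longleftrightarrow> alternating n c D" using True by (simp add: D)
    finally show ?thesis .
  next
    case False
    then show ?thesis unfolding D alternating.simps by blast
  qed
qed

lemma gyrate_gyrate:
  assumes "c \<in> edges n \<rightarrow>\<^sub>E UNIV"
  shows "gyrate n p (gyrate n p c) = c"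
proof
  fix e
  show "gyrate n p (gyrate n p c) e = c e"
  proof (cases "e \<in> edges n")
    case True
    then obtain D where "D \<in> cells n p" "e \<in> sides D" using ex_cell_side by blast
    then show ?thesis using gyrate_side[OF _ _ True] alternating_gyrate by simp
  next
    case False
    moreover have "c e = undefined" using assms False by (rule PiE_arb)
    ultimately show ?thesis by (simp add: gyrate_def)
  qed
qed

definition end_color :: "nat \<Rightarrow> bool \<Rightarrow> vertex \<Rightarrow> color" where
  "end_color n b v = (if b then flip (endpoint_color n v) else endpoint_color n v)"

definition ends :: "nat \<Rightarrow> bool \<Rightarrow> color \<Rightarrow> vertex set" where
  "ends n b k = {v \<in> endpoints n. end_color n b v = k}"

text \<open>One half-step of the gyration flips all end edges; \<open>b\<close> records whether the boundary colors
  are currently swapped.\<close>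

definition twisted_colorings :: "nat \<Rightarrow> bool \<Rightarrow> (vertex set \<Rightarrow> color) set" where
  "twisted_colorings n b = {c \<in> edges n \<rightarrow>\<^sub>E UNIV.
    (\<forall>v \<in> interior_vertices n. \<forall>k. card {e \<in> edges n. v \<in> e \<and> c e = k} = 2) \<and>
    (\<forall>v \<in> endpoints n. \<forall>e \<in> edges n. v \<in> e \<longrightarrow> c e = end_color n b v)}"

lemma twisted_colorings_False: "twisted_colorings n False = admissible_colorings n"
  by (simp add: twisted_colorings_def admissible_colorings_def end_color_def)

text \<open>The balance at a vertex, written for a grouping of its edges into two pairs: both pairs
  are mixed, or both are monochromatic and opposite. The pairs are later those of the two cells at
  the vertex.\<close>

lemma two_of_each_iff:
  assumes "distinct [e1, e2, e3, e4]"
  shows "(\<forall>k. card {e \<in> {e1, e2, e3, e4}. c e = k} = 2) \<longleftrightarrow>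
    (c e1 = c e2 \<and> c e3 = c e4 \<and> c e1 \<noteq> c e3) \<or> (c e1 \<noteq> c e2 \<and> c e3 \<noteq> (c e4 :: color))"
proof -
  have "card {e \<in> {e1, e2, e3, e4}. c e = k} = (\<Sum>e \<in> {e1, e2, e3, e4}. if c e = k then 1 else 0)" for k
    unfolding card_eq_sum by (rule sum.inter_filter) simp
  then have card: "card {e \<in> {e1, e2, e3, e4}. c e = k} = (if c e1 = k then 1 else 0) +
      (if c e2 = k then 1 else 0) + (if c e3 = k then 1 else 0) + (if c e4 = k then 1 else 0)" for k
    using assms by simp
  have all: "(\<forall>k. P k) \<longleftrightarrow> P Blue \<and> P Green" for P
    by (metis color.exhaust)
  show ?thesis unfolding card all
    by (cases "c e1"; cases "c e2"; cases "c e3"; cases "c e4") simp_all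
qed

lemma twisted_two_of_each:
  assumes "c \<in> twisted_colorings n b" "v \<in> interior_vertices n"
    "{e \<in> edges n. v \<in> e} = {e1, e2, e3, e4}" "distinct [e1, e2, e3, e4]"
  shows "(c e1 = c e2 \<and> c e3 = c e4 \<and> c e1 \<noteq> c e3) \<or> (c e1 \<noteq> c e2 \<and> c e3 \<noteq> c e4)"
proof -
  have "{e \<in> edges n. v \<in> e \<and> c e = k} = {e \<in> {e1, e2, e3, e4}. c e = k}" for k
    using assms(3) by blast
  moreover have "card {e \<in> edges n. v \<in> e \<and> c e = k} = 2" for k
    using assms(1,2) by (simp add: twisted_colorings_def)
  ultimately show ?thesis
    unfolding two_of_each_iff[OF assms(4), of c, symmetric] by metis
qed

lemma ex_cell_corner:
  assumes "v \<in> interior_vertices n"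
  shows "\<exists>D \<in> cells n p. v \<in> corners D"
proof -
  obtain x y where v: "v = (x, y)" by (cases v)
  then have "hedge x y \<in> edges n" "v \<in> hedge x y" using assms by auto
  then show ?thesis using ex_cell_side[of "hedge x y" n p] side_subset_corners by blast
qed

lemma alternating_neq:
  assumes "alternating n c D" "e \<in> sides D" "e' \<in> sides D" "v \<in> e" "v \<in> e'" "e \<noteq> e'"
  shows "c e \<noteq> c e'"
proof -
  obtain i j x y where "D = (i, j)" "v = (x, y)" by (cases D; cases v) auto
  then show ?thesis using assms by auto
qed

text \<open>A mixed pair stays mixed whether its cell flips or not. A monochromatic pair cannot lie
  in an alternating cell, so two opposite monochromatic pairs are both flipped and remain
  opposite.\<close>

lemma gyrate_twisted:
  assumes c: "c \<in> twisted_colorings n b"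
  shows "gyrate n p c \<in> twisted_colorings n (\<not> b)"
proof -
  have "\<forall>k. card {e \<in> edges n. v \<in> e \<and> gyrate n p c e = k} = 2" if v: "v \<in> interior_vertices n" for v
  proof -
    obtain D where D: "D \<in> cells n p" "v \<in> corners D" using ex_cell_corner[OF v] by blast
    obtain D' e1 e2 e3 e4 where D': "D' \<in> cells n p" and dist: "distinct [e1, e2, e3, e4]"
      and e: "{e \<in> edges n. v \<in> e} = {e1, e2, e3, e4}"
      "{e \<in> sides D. v \<in> e} = {e1, e2}" "{e \<in> sides D'. v \<in> e} = {e3, e4}"
      by (rule corner_split[OF v D]) (rule that; assumption)
    have "e1 \<in> edges n" "e2 \<in> edges n" "e3 \<in> edges n" "e4 \<in> edges n" using e(1) by blast+
    moreover have s: "e1 \<in> sides D" "e2 \<in> sides D" "e3 \<in> sides D'" "e4 \<in> sides D'"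
      "v \<in> e1" "v \<in> e2" "v \<in> e3" "v \<in> e4" using e(2,3) by blast+
    ultimately have g: "gyrate n p c e1 = (if alternating n c D then c e1 else flip (c e1))"
      "gyrate n p c e2 = (if alternating n c D then c e2 else flip (c e2))"
      "gyrate n p c e3 = (if alternating n c D' then c e3 else flip (c e3))"
      "gyrate n p c e4 = (if alternating n c D' then c e4 else flip (c e4))"
      using gyrate_side D D' by auto
    have "alternating n c D \<Longrightarrow> c e1 \<noteq> c e2" "alternating n c D' \<Longrightarrow> c e3 \<noteq> c e4"
      using alternating_neq[OF _ s(1,2,5,6)] alternating_neq[OF _ s(3,4,7,8)] dist by simp_all
    then have "(gyrate n p c e1 = gyrate n p c e2 \<and> gyrate n p c e3 = gyrate n p c e4 \<and>
        gyrate n p c e1 \<noteq> gyrate n p c e3) \<or>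
      (gyrate n p c e1 \<noteq> gyrate n p c e2 \<and> gyrate n p c e3 \<noteq> gyrate n p c e4)"
      using twisted_two_of_each[OF c v e(1) dist] unfolding g by auto
    moreover have "{e \<in> edges n. v \<in> e \<and> gyrate n p c e = k} = {e \<in> {e1, e2, e3, e4}. gyrate n p c e = k}" for k
      using e(1) by blast
    ultimately show ?thesis using two_of_each_iff[OF dist, of "gyrate n p c"] by simp
  qed
  moreover have "gyrate n p c e = end_color n (\<not> b) v"
    if v: "v \<in> endpoints n" "e \<in> edges n" "v \<in> e" for v e
  proof -
    obtain D where D: "D \<in> cells n p" "e \<in> sides D" using ex_cell_side[OF v(2)] by blast
    then have "\<not> sides D \<subseteq> edges n"
      using v endpoint_cell_not_full side_subset_corners by blast
    then have "\<not> alternating n c D" using alternating_sides by blast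
    then have "gyrate n p c e = flip (c e)" using gyrate_side[OF D v(2)] by simp
    moreover have "c e = end_color n b v" using c v by (simp add: twisted_colorings_def)
    ultimately show ?thesis by (cases b) (simp_all add: end_color_def)
  qed
  moreover have "gyrate n p c \<in> edges n \<rightarrow>\<^sub>E UNIV"
    by (simp add: gyrate_def)
  ultimately show ?thesis by (simp add: twisted_colorings_def)
qed

section \<open>Split vertices and connections inside a cell\<close>

text \<open>The universal form makes every endpoint split, since it has only one edge. Thus path
  ends are among the points whose connections are followed.\<close>

definition split_vertices :: "nat \<Rightarrow> bool \<Rightarrow> (vertex set \<Rightarrow> color) \<Rightarrow> vertex set" where
  "split_vertices n p c = {v \<in> interior_vertices n \<union> endpoints n.
    \<forall>D \<in> cells n p. \<forall>e \<in> sides D \<inter> edges n. \<forall>e' \<in> sides D \<inter> edges n.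
      v \<in> e \<and> v \<in> e' \<and> e \<noteq> e' \<longrightarrow> c e \<noteq> c e'}"

lemma split_gyrate: "split_vertices n p (gyrate n p c) = split_vertices n p c"
proof -
  have "gyrate n p c e = gyrate n p c e' \<longleftrightarrow> c e = c e'"
    if "D \<in> cells n p" "e \<in> sides D \<inter> edges n" "e' \<in> sides D \<inter> edges n" for D e e'
    using that gyrate_side[OF that(1), of e c] gyrate_side[OF that(1), of e' c]
    by (cases "alternating n c D"; cases "c e"; cases "c e'") simp_all
  then show ?thesis unfolding split_vertices_def by blast
qed

lemma endpoints_subset_split: "endpoints n \<subseteq> split_vertices n p c"
  unfolding split_vertices_def by (blast dest: edge_at_endpoint_unique)

lemma splitD:
  assumes "v \<in> split_vertices n p c" "D \<in> cells n p" "e \<in> sides D \<inter> edges n" "e' \<in> sides D \<inter> edges n"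
    "v \<in> e" "v \<in> e'" "e \<noteq> e'"
  shows "c e \<noteq> c e'"
  using assms unfolding split_vertices_def by blast

text \<open>The two endpoints in a boundary cell are joined regardless of color. The half-step moves the
  end of a path from one to the other, so with this link connectivity is literally preserved.\<close>

definition cell_rel :: "nat \<Rightarrow> color \<Rightarrow> (vertex set \<Rightarrow> color) \<Rightarrow> vertex \<Rightarrow> vertex rel" where
  "cell_rel n k c D = {(u, v). {u, v} \<in> sides D \<inter> edges n \<and> c {u, v} = k} \<union>
     (corners D \<inter> endpoints n) \<times> (corners D \<inter> endpoints n)"

lemma sym_cell_rel: "sym (cell_rel n k c D)"
  unfolding cell_rel_def by (auto intro!: symI simp: insert_commute)

text \<open>One monochromatic pair at the vertex forces the other to be monochromatic of the
  opposite color. So all edges of one color at a vertex that is not split are sides of a single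
  cell, and a path of that color cannot leave the cell there.\<close>

lemma nonsplit_sides_eq:
  assumes c: "c \<in> twisted_colorings n b" and z: "z \<in> interior_vertices n" "z \<notin> split_vertices n p c"
    and D: "D \<in> cells n p" and e: "e \<in> sides D" "e' \<in> sides D" "z \<in> e" "z \<in> e'"
  shows "c e = c e'" "e \<in> edges n"
    and "f \<in> edges n \<Longrightarrow> z \<in> f \<Longrightarrow> c f = c e \<Longrightarrow> f \<in> sides D"
proof -
  have zD: "z \<in> corners D" using e side_subset_corners by blast
  obtain D' e1 e2 e3 e4 where D': "D' \<in> cells n p" "D' \<noteq> D" "distinct [e1, e2, e3, e4]"
    and at: "{e \<in> edges n. z \<in> e} = {e1, e2, e3, e4}"
    "{e \<in> sides D. z \<in> e} = {e1, e2}" "{e \<in> sides D'. z \<in> e} = {e3, e4}"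
    and only: "\<forall>C \<in> cells n p. z \<in> corners C \<longrightarrow> C = D \<or> C = D'"
    by (rule corner_split[OF z(1) D zD]) (rule that; assumption)
  obtain C f f' where C: "C \<in> cells n p" "f \<in> sides C" "f' \<in> sides C" "z \<in> f" "z \<in> f'" "f \<noteq> f'" "c f = c f'"
    using z unfolding split_vertices_def by blast
  then have "C = D \<or> C = D'" using only side_subset_corners by blast
  then have "c e1 = c e2 \<or> c e3 = c e4"
  proof
    assume "C = D"
    then have "f \<in> {e1, e2}" "f' \<in> {e1, e2}" using C at(2) by blast+
    then show ?thesis using C by auto
  next
    assume "C = D'"
    then have "f \<in> {e3, e4}" "f' \<in> {e3, e4}" using C at(3) by blast+
    then show ?thesis using C by auto
  qed
  then have eq: "c e1 = c e2" "c e3 = c e4" "c e1 \<noteq> c e3"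
    using twisted_two_of_each[OF c z(1) at(1) D'(3)] by auto
  have ee: "e \<in> {e1, e2}" "e' \<in> {e1, e2}" using e at(2) by blast+
  then show "c e = c e'" using eq by auto
  show "e \<in> edges n" using ee(1) at(1) by blast
  show "g \<in> sides D" if "g \<in> edges n" "z \<in> g" "c g = c e" for g
  proof -
    have "g \<in> {e1, e2, e3, e4}" using that at(1) by blast
    then have "g \<in> {e1, e2}" using that(3) ee(1) eq by auto
    then show ?thesis using at(2) by blast
  qed
qed

text \<open>This supplies the hypothesis \<open>own_cell\<close> of the contraction. The links
  between endpoints cause no trouble, as endpoints are split.\<close>

lemma cell_rel_own_cell:
  assumes c: "c \<in> twisted_colorings n b" and z: "z \<notin> split_vertices n p c"
    and D: "D \<in> cells n p" "D' \<in> cells n p"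
    and dom: "z \<in> Domain (cell_rel n k c D)" "z \<in> Domain (cell_rel n k c D')"
  shows "D = D'"
proof -
  have "z \<notin> endpoints n" using z endpoints_subset_split by blast
  then obtain w w' where w: "{z, w} \<in> sides D" "{z, w} \<in> edges n" "c {z, w} = k"
    "{z, w'} \<in> sides D'" "{z, w'} \<in> edges n" "c {z, w'} = k"
    using dom unfolding cell_rel_def by auto
  then have "z \<in> interior_vertices n"
    using edge_vertices[of "{z, w}" n z] \<open>z \<notin> endpoints n\<close> by auto
  then have "{z, w'} \<in> sides D"
    using nonsplit_sides_eq(3)[OF c _ z D(1) w(1) w(1), of "{z, w'}"] w by simp
  then show ?thesis using side_cell_unique[OF D] w(4) by blast
qed

text \<open>Here \<open>e1\<close> to \<open>e4\<close> say which sides have the chosen color and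
  \<open>f\<close> gives the class of a corner. Around a cell that does not alternate, the sides of
  that color form at most one run, and the corners where the color changes are the two ends of the
  run.\<close>

lemma square_connected:
  assumes "e1 \<Longrightarrow> f v1 = f v2" "e2 \<Longrightarrow> f v2 = f v3" "e3 \<Longrightarrow> f v3 = f v4" "e4 \<Longrightarrow> f v4 = f v1"
    and "\<not> (e1 = e3 \<and> e2 = e4 \<and> e1 \<noteq> e2)"
    and "x = v1 \<and> e4 \<noteq> e1 \<or> x = v2 \<and> e1 \<noteq> e2 \<or> x = v3 \<and> e2 \<noteq> e3 \<or> x = v4 \<and> e3 \<noteq> e4"
    and "y = v1 \<and> e4 \<noteq> e1 \<or> y = v2 \<and> e1 \<noteq> e2 \<or> y = v3 \<and> e2 \<noteq> e3 \<or> y = v4 \<and> e3 \<noteq> e4"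
  shows "f x = f y"
  using assms by (smt (verit))

text \<open>A rim cell away from the corners of the square: \<open>v1\<close> and \<open>v2\<close>
  are its linked endpoints, and \<open>e2\<close> and \<open>e4\<close> belong to their edges, which
  differ in color. The run of the chosen color starts at one endpoint and stops at the one inner
  corner where the color changes.\<close>

lemma side_connected:
  assumes "f v1 = f v2" "e2 \<Longrightarrow> f v2 = f v3" "e3 \<Longrightarrow> f v3 = f v4" "e4 \<Longrightarrow> f v4 = f v1"
    and "e2 \<noteq> e4"
    and "x = v1 \<or> x = v2 \<or> x = v3 \<and> e2 \<noteq> e3 \<or> x = v4 \<and> e3 \<noteq> e4"
    and "y = v1 \<or> y = v2 \<or> y = v3 \<and> e2 \<noteq> e3 \<or> y = v4 \<and> e3 \<noteq> e4"
  shows "f x = f y"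
  using assms by (smt (verit))

text \<open>A cell at a corner of the square: \<open>v1\<close> and \<open>v3\<close> are its linked
  endpoints, \<open>v2\<close> is its only interior corner, and one of the two edges has the chosen
  color.\<close>

lemma corner_connected:
  assumes "f v1 = f v3" "e1 \<Longrightarrow> f v1 = f v2" "e2 \<Longrightarrow> f v2 = f v3" "e1 \<noteq> e2"
    and "x = v1 \<or> x = v2 \<or> x = v3" "y = v1 \<or> y = v2 \<or> y = v3"
  shows "f x = f y"
  using assms by metis

lemma sym_rtrancl_class_eq_iff:
  assumes "sym r"
  shows "r\<^sup>* `` {u} = r\<^sup>* `` {v} \<longleftrightarrow> (u, v) \<in> r\<^sup>*"
  using sym_rtrancl_Image_eq[OF assms] by blast

lemma color_neq_iff: "a \<noteq> b \<longleftrightarrow> (a = k) \<noteq> (b = (k :: color))"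
  by (cases a; cases b; cases k) auto

text \<open>In a full cell that does not alternate, the color changes at most twice around the boundary,
  and the two corners where it changes are joined by an arc of either color.\<close>

lemma split_connected_in_cell:
  assumes c: "c \<in> twisted_colorings n b" and D: "D \<in> cells n p" "\<not> alternating n c D"
    and x: "x \<in> split_vertices n p c" "x \<in> corners D"
    and y: "y \<in> split_vertices n p c" "y \<in> corners D"
  shows "(x, y) \<in> (cell_rel n k c D)\<^sup>*"
proof -
  obtain i j where ij: "D = (i, j)" by (cases D)
  \<comment> \<open>Passing to classes turns connectivity into equality, so the propositional lemmas
    above apply.\<close>
  define f where "f v = (cell_rel n k c D)\<^sup>* `` {v}" for v
  let ?e1 = "hedge i j" and ?e2 = "vedge (i + 1) j" and ?e3 = "hedge i (j + 1)" and ?e4 = "vedge i j"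
  let ?v1 = "(i, j)" and ?v2 = "(i + 1, j)" and ?v3 = "(i + 1, j + 1)" and ?v4 = "(i, j + 1)"
  have link: "f u = f v" if "{u, v} \<in> sides D \<inter> edges n" "c {u, v} = k" for u v
    using that sym_rtrancl_class_eq_iff[OF sym_cell_rel, of n k c D u v]
    by (auto simp: f_def cell_rel_def)
  have links: "?e1 \<in> edges n \<Longrightarrow> c ?e1 = k \<Longrightarrow> f ?v1 = f ?v2"
    "?e2 \<in> edges n \<Longrightarrow> c ?e2 = k \<Longrightarrow> f ?v2 = f ?v3"
    "?e3 \<in> edges n \<Longrightarrow> c ?e3 = k \<Longrightarrow> f ?v3 = f ?v4"
    "?e4 \<in> edges n \<Longrightarrow> c ?e4 = k \<Longrightarrow> f ?v4 = f ?v1"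
    using link[of ?v1 ?v2] link[of ?v2 ?v3] link[of ?v4 ?v3] link[of ?v1 ?v4]
    by (simp_all add: ij flip: hedge_def vedge_def)
  have jump: "f u = f v" if "u \<in> corners D" "v \<in> corners D" "u \<in> endpoints n" "v \<in> endpoints n" for u v
    using that sym_rtrancl_class_eq_iff[OF sym_cell_rel, of n k c D u v]
    by (auto simp: f_def cell_rel_def)
  have bd: "(c e = k) = (end_color n b v = k)" if "v \<in> endpoints n" "e \<in> edges n" "v \<in> e" for v e
    using c that by (simp add: twisted_colorings_def)
  have sp: "(z = ?v1 \<and> (?e1 \<in> edges n \<and> ?e4 \<in> edges n \<longrightarrow> (c ?e4 = k) \<noteq> (c ?e1 = k)) \<or>
      z = ?v2 \<and> (?e1 \<in> edges n \<and> ?e2 \<in> edges n \<longrightarrow> (c ?e1 = k) \<noteq> (c ?e2 = k)) \<or>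
      z = ?v3 \<and> (?e2 \<in> edges n \<and> ?e3 \<in> edges n \<longrightarrow> (c ?e2 = k) \<noteq> (c ?e3 = k)) \<or>
      z = ?v4 \<and> (?e3 \<in> edges n \<and> ?e4 \<in> edges n \<longrightarrow> (c ?e3 = k) \<noteq> (c ?e4 = k))) \<and>
      z \<in> interior_vertices n \<union> endpoints n"
    if z: "z \<in> split_vertices n p c" "z \<in> corners D" for z
  proof -
    have ne: "c e \<noteq> c e'" if "e \<in> sides D \<inter> edges n" "e' \<in> sides D \<inter> edges n" "z \<in> e" "z \<in> e'" "e \<noteq> e'" for e e'
      using splitD[OF z(1) D(1)] that by blast
    have "z = ?v1 \<Longrightarrow> ?e1 \<in> edges n \<Longrightarrow> ?e4 \<in> edges n \<Longrightarrow> c ?e4 \<noteq> c ?e1"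
      "z = ?v2 \<Longrightarrow> ?e1 \<in> edges n \<Longrightarrow> ?e2 \<in> edges n \<Longrightarrow> c ?e1 \<noteq> c ?e2"
      "z = ?v3 \<Longrightarrow> ?e2 \<in> edges n \<Longrightarrow> ?e3 \<in> edges n \<Longrightarrow> c ?e2 \<noteq> c ?e3"
      "z = ?v4 \<Longrightarrow> ?e3 \<in> edges n \<Longrightarrow> ?e4 \<in> edges n \<Longrightarrow> c ?e3 \<noteq> c ?e4"
      by (rule ne; simp add: ij)+
    moreover have "z = ?v1 \<or> z = ?v2 \<or> z = ?v3 \<or> z = ?v4" using z(2) by (auto simp: ij)
    moreover have "z \<in> interior_vertices n \<union> endpoints n" using z(1) by (simp add: split_vertices_def)
    ultimately show ?thesis unfolding color_neq_iff[symmetric] by blast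
  qed
  note spx = sp[OF x] and spy = sp[OF y]
  have n: "1 \<le> n" using x(1) by (cases x) (auto simp: split_vertices_def)
  have par: "end_color n b u = k \<longleftrightarrow> end_color n b v \<noteq> k" if "endpoint_color n u \<noteq> endpoint_color n v" for u v
  proof -
    have "end_color n b u \<noteq> end_color n b v" using that by (simp add: end_color_def)
    then show ?thesis unfolding color_neq_iff[of "end_color n b u" "end_color n b v" k] by blast
  qed
  have range: "0 \<le> i" "i \<le> int n" "0 \<le> j" "j \<le> int n" using D(1) by (auto simp: ij)
  have "i = 0 \<or> i = int n \<or> 0 < i \<and> i < int n" "j = 0 \<or> j = int n \<or> 0 < j \<and> j < int n"
    using range by linarith+
  \<comment> \<open>One inner case, four sides of the rim, four corners of the square. On the rim
    the two end edges differ in color, so one of them has color \<open>k\<close>, and the link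
    between the endpoints replaces the missing sides.\<close>
  then consider "0 < i" "i < int n" "0 < j" "j < int n"
    | "0 < i" "i < int n" "j = 0" | "0 < i" "i < int n" "j = int n"
    | "i = 0" "0 < j" "j < int n" | "i = int n" "0 < j" "j < int n"
    | "i = 0" "j = 0" | "i = int n" "j = 0" | "i = 0" "j = int n" | "i = int n" "j = int n"
    by blast
  then have "f x = f y"
  proof cases
    case 1
    then have ed: "?e1 \<in> edges n" "?e2 \<in> edges n" "?e3 \<in> edges n" "?e4 \<in> edges n" by auto
    have na: "\<not> ((c ?e1 = k) = (c ?e3 = k) \<and> (c ?e2 = k) = (c ?e4 = k) \<and> (c ?e1 = k) \<noteq> (c ?e2 = k))"
      using D(2) ed color_neq_iff[of "c ?e1" "c ?e3" k] color_neq_iff[of "c ?e2" "c ?e4" k]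
        color_neq_iff[of "c ?e1" "c ?e2" k] by (auto simp: ij)
    show ?thesis
      by (rule square_connected[of "c ?e1 = k" f ?v1 ?v2 "c ?e2 = k" ?v3 "c ?e3 = k" ?v4 "c ?e4 = k"];
        (erule links(1)[OF ed(1)] links(2)[OF ed(2)] links(3)[OF ed(3)] links(4)[OF ed(4)] | rule na | use spx spy ed in blast))
  next
    case 2
    then have ed: "?e2 \<in> edges n" "?e3 \<in> edges n" "?e4 \<in> edges n" by auto
    have "(c ?e2 = k) \<noteq> (c ?e4 = k)"
      using par[of "(i + 1, j)" "(i, j)"] bd[of ?v2 ?e2] bd[of ?v1 ?e4] 2 by simp
    moreover have "f ?v1 = f ?v2" by (rule jump; use 2 in \<open>simp add: ij\<close>)
    moreover have "x = ?v1 \<or> x = ?v2 \<or> x = ?v3 \<and> (c ?e2 = k) \<noteq> (c ?e3 = k) \<or> x = ?v4 \<and> (c ?e3 = k) \<noteq> (c ?e4 = k)"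
      using spx ed by blast
    moreover have "y = ?v1 \<or> y = ?v2 \<or> y = ?v3 \<and> (c ?e2 = k) \<noteq> (c ?e3 = k) \<or> y = ?v4 \<and> (c ?e3 = k) \<noteq> (c ?e4 = k)"
      using spy ed by blast
    ultimately show ?thesis
      using side_connected[of f ?v1 ?v2 "c ?e2 = k" ?v3 "c ?e3 = k" ?v4 "c ?e4 = k" x y]
        links(2)[OF ed(1)] links(3)[OF ed(2)] links(4)[OF ed(3)] by blast
  next
    case 3
    then have ed: "?e4 \<in> edges n" "?e1 \<in> edges n" "?e2 \<in> edges n" by auto
    have "(c ?e4 = k) \<noteq> (c ?e2 = k)"
      using par[of "(i, j + 1)" "(i + 1, j + 1)"] bd[of ?v3 ?e2] bd[of ?v4 ?e4] 3 by simp
    moreover have "f ?v3 = f ?v4" by (rule jump; use 3 in \<open>simp add: ij\<close>)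
    moreover have "x = ?v3 \<or> x = ?v4 \<or> x = ?v1 \<and> (c ?e4 = k) \<noteq> (c ?e1 = k) \<or> x = ?v2 \<and> (c ?e1 = k) \<noteq> (c ?e2 = k)"
      using spx ed by blast
    moreover have "y = ?v3 \<or> y = ?v4 \<or> y = ?v1 \<and> (c ?e4 = k) \<noteq> (c ?e1 = k) \<or> y = ?v2 \<and> (c ?e1 = k) \<noteq> (c ?e2 = k)"
      using spy ed by blast
    ultimately show ?thesis
      using side_connected[of f ?v3 ?v4 "c ?e4 = k" ?v1 "c ?e1 = k" ?v2 "c ?e2 = k" x y]
        links(4)[OF ed(1)] links(1)[OF ed(2)] links(2)[OF ed(3)] by blast
  next
    case 4
    then have ed: "?e1 \<in> edges n" "?e2 \<in> edges n" "?e3 \<in> edges n" by auto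
    have "(c ?e1 = k) \<noteq> (c ?e3 = k)"
      using par[of "(i, j)" "(i, j + 1)"] bd[of ?v1 ?e1] bd[of ?v4 ?e3] 4 by simp
    moreover have "f ?v4 = f ?v1" by (rule jump; use 4 in \<open>simp add: ij\<close>)
    moreover have "x = ?v4 \<or> x = ?v1 \<or> x = ?v2 \<and> (c ?e1 = k) \<noteq> (c ?e2 = k) \<or> x = ?v3 \<and> (c ?e2 = k) \<noteq> (c ?e3 = k)"
      using spx ed by blast
    moreover have "y = ?v4 \<or> y = ?v1 \<or> y = ?v2 \<and> (c ?e1 = k) \<noteq> (c ?e2 = k) \<or> y = ?v3 \<and> (c ?e2 = k) \<noteq> (c ?e3 = k)"
      using spy ed by blast
    ultimately show ?thesis
      using side_connected[of f ?v4 ?v1 "c ?e1 = k" ?v2 "c ?e2 = k" ?v3 "c ?e3 = k" x y]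
        links(1)[OF ed(1)] links(2)[OF ed(2)] links(3)[OF ed(3)] by blast
  next
    case 5
    then have ed: "?e3 \<in> edges n" "?e4 \<in> edges n" "?e1 \<in> edges n" by auto
    have "(c ?e3 = k) \<noteq> (c ?e1 = k)"
      using par[of "(i + 1, j)" "(i + 1, j + 1)"] bd[of ?v2 ?e1] bd[of ?v3 ?e3] 5 by simp
    moreover have "f ?v2 = f ?v3" by (rule jump; use 5 in \<open>simp add: ij\<close>)
    moreover have "x = ?v2 \<or> x = ?v3 \<or> x = ?v4 \<and> (c ?e3 = k) \<noteq> (c ?e4 = k) \<or> x = ?v1 \<and> (c ?e4 = k) \<noteq> (c ?e1 = k)"
      using spx ed by blast
    moreover have "y = ?v2 \<or> y = ?v3 \<or> y = ?v4 \<and> (c ?e3 = k) \<noteq> (c ?e4 = k) \<or> y = ?v1 \<and> (c ?e4 = k) \<noteq> (c ?e1 = k)"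
      using spy ed by blast
    ultimately show ?thesis
      using side_connected[of f ?v2 ?v3 "c ?e3 = k" ?v4 "c ?e4 = k" ?v1 "c ?e1 = k" x y]
        links(3)[OF ed(1)] links(4)[OF ed(2)] links(1)[OF ed(3)] by blast
  next
    case 6
    have "(c ?e2 = k) \<noteq> (c ?e3 = k)"
      using par[of "(i + 1, j)" "(i, j + 1)"] bd[of ?v2 ?e2] bd[of ?v4 ?e3] 6 n by simp
    moreover have "f ?v2 = f ?v4" by (rule jump; use 6 n in \<open>simp add: ij\<close>)
    moreover have ed: "?e2 \<in> edges n" "?e3 \<in> edges n" using 6 n by simp_all
    moreover have "?v1 \<notin> interior_vertices n \<union> endpoints n" using 6 n by simp
    then have "x = ?v2 \<or> x = ?v3 \<or> x = ?v4" "y = ?v2 \<or> y = ?v3 \<or> y = ?v4"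
      using spx spy by blast+
    ultimately show ?thesis
      using corner_connected[of f ?v2 ?v4 "c ?e2 = k" ?v3 "c ?e3 = k" x y]
        links(2)[OF ed(1)] links(3)[OF ed(2)] by metis
  next
    case 7
    have "(c ?e4 = k) \<noteq> (c ?e3 = k)"
      using par[of "(i, j)" "(i + 1, j + 1)"] bd[of ?v1 ?e4] bd[of ?v3 ?e3] 7 n by simp
    moreover have "f ?v1 = f ?v3" by (rule jump; use 7 n in \<open>simp add: ij\<close>)
    moreover have ed: "?e4 \<in> edges n" "?e3 \<in> edges n" using 7 n by simp_all
    moreover have "?v2 \<notin> interior_vertices n \<union> endpoints n" using 7 n by simp
    then have "x = ?v1 \<or> x = ?v4 \<or> x = ?v3" "y = ?v1 \<or> y = ?v4 \<or> y = ?v3"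
      using spx spy by blast+
    ultimately show ?thesis
      using corner_connected[of f ?v1 ?v3 "c ?e4 = k" ?v4 "c ?e3 = k" x y]
        links(4)[OF ed(1)] links(3)[OF ed(2)] by metis
  next
    case 8
    have "(c ?e1 = k) \<noteq> (c ?e2 = k)"
      using par[of "(i, j)" "(i + 1, j + 1)"] bd[of ?v1 ?e1] bd[of ?v3 ?e2] 8 n by simp
    moreover have "f ?v1 = f ?v3" by (rule jump; use 8 n in \<open>simp add: ij\<close>)
    moreover have ed: "?e1 \<in> edges n" "?e2 \<in> edges n" using 8 n by simp_all
    moreover have "?v4 \<notin> interior_vertices n \<union> endpoints n" using 8 n by simp
    then have "x = ?v1 \<or> x = ?v2 \<or> x = ?v3" "y = ?v1 \<or> y = ?v2 \<or> y = ?v3"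
      using spx spy by blast+
    ultimately show ?thesis
      using corner_connected[of f ?v1 ?v3 "c ?e1 = k" ?v2 "c ?e2 = k" x y]
        links(1)[OF ed(1)] links(2)[OF ed(2)] by metis
  next
    case 9
    have "(c ?e1 = k) \<noteq> (c ?e4 = k)"
      using par[of "(i + 1, j)" "(i, j + 1)"] bd[of ?v2 ?e1] bd[of ?v4 ?e4] 9 n by simp
    moreover have "f ?v2 = f ?v4" by (rule jump; use 9 n in \<open>simp add: ij\<close>)
    moreover have ed: "?e1 \<in> edges n" "?e4 \<in> edges n" using 9 n by simp_all
    moreover have "?v3 \<notin> interior_vertices n \<union> endpoints n" using 9 n by simp
    then have "x = ?v2 \<or> x = ?v1 \<or> x = ?v4" "y = ?v2 \<or> y = ?v1 \<or> y = ?v4"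
      using spx spy by blast+
    ultimately show ?thesis
      using corner_connected[of f ?v2 ?v4 "c ?e1 = k" ?v1 "c ?e4 = k" x y]
        links(1)[OF ed(1)] links(4)[OF ed(2)] by metis
  qed
  then show ?thesis
    using sym_rtrancl_class_eq_iff[OF sym_cell_rel] unfolding f_def by blast
qed

section \<open>Components and cycles\<close>

definition coupled_rel :: "nat \<Rightarrow> bool \<Rightarrow> color \<Rightarrow> (vertex set \<Rightarrow> color) \<Rightarrow> vertex rel" where
  "coupled_rel n p k c = (\<Union>D \<in> cells n p. cell_rel n k c D)"

lemma sym_coupled_rel: "sym (coupled_rel n p k c)"
  unfolding coupled_rel_def by (rule sym_UNION) (simp add: sym_cell_rel)

text \<open>Every edge is a side of some cell of parity \<open>p\<close>, so the cells reassemble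
  the whole one-colored graph. The parity survives only in the choice of the links at the
  rim.\<close>

lemma coupled_rel_eq:
  "coupled_rel n p k c = adjacency (colored_edges n c k) \<union>
     (\<Union>D \<in> cells n p. (corners D \<inter> endpoints n) \<times> (corners D \<inter> endpoints n))"
proof -
  have "\<exists>D \<in> cells n p. {u, v} \<in> sides D" if "{u, v} \<in> edges n" for u v
    using ex_cell_side[OF that] .
  then show ?thesis
    unfolding coupled_rel_def cell_rel_def colored_edges_def adjacency_def by blast
qed

lemma cell_rel_rtrancl_corners:
  assumes "(x, y) \<in> (cell_rel n k c D)\<^sup>*"
  shows "x = y \<or> x \<in> corners D \<and> y \<in> corners D"
proof -
  have "u \<in> corners D \<and> v \<in> corners D" if "(u, v) \<in> cell_rel n k c D" for u v
    using that side_subset_corners[of "{u, v}" D] by (auto simp: cell_rel_def)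
  then show ?thesis using assms by (metis converse_rtranclE rtranclE)
qed

text \<open>Both closures contract to connections between split vertices inside single cells. An
  alternating cell does not change, and in every other cell all split corners are joined both before
  and after, in either color.\<close>

lemma split_connected_gyrate:
  assumes c: "c \<in> twisted_colorings n b"
    and xy: "x \<in> split_vertices n p c" "y \<in> split_vertices n p c"
  shows "(x, y) \<in> (coupled_rel n p k (gyrate n p c))\<^sup>* \<longleftrightarrow> (x, y) \<in> (coupled_rel n p k c)\<^sup>*"
proof -
  let ?F = "split_vertices n p c" and ?c' = "gyrate n p c"
  have c': "?c' \<in> twisted_colorings n (\<not> b)" by (rule gyrate_twisted[OF c])
  have "(cell_rel n k ?c' D)\<^sup>* \<inter> ?F \<times> ?F = (cell_rel n k c D)\<^sup>* \<inter> ?F \<times> ?F" if D: "D \<in> cells n p" for D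
  proof (cases "alternating n c D")
    case True
    then have "?c' e = c e" if "e \<in> sides D \<inter> edges n" for e
      using that gyrate_side[OF D] by simp
    then have "cell_rel n k ?c' D = cell_rel n k c D"
      unfolding cell_rel_def by auto
    then show ?thesis by simp
  next
    case False
    then have "\<not> alternating n ?c' D" using alternating_gyrate[OF D] by simp
    then have "(u, v) \<in> (cell_rel n k c D)\<^sup>* \<and> (u, v) \<in> (cell_rel n k ?c' D)\<^sup>*"
      if "u \<in> ?F" "v \<in> ?F" "u \<in> corners D" "v \<in> corners D" for u v
      using that False split_connected_in_cell[OF c D] split_connected_in_cell[OF c' D]
      by (simp add: split_gyrate)
    then show ?thesis using cell_rel_rtrancl_corners by fast
  qed
  then have "(\<Union>D \<in> cells n p. (cell_rel n k ?c' D)\<^sup>* \<inter> ?F \<times> ?F) =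
    (\<Union>D \<in> cells n p. (cell_rel n k c D)\<^sup>* \<inter> ?F \<times> ?F)" by (intro SUP_cong) auto
  moreover have "(x, y) \<in> (coupled_rel n p k c)\<^sup>* \<longleftrightarrow>
      (x, y) \<in> (\<Union>D \<in> cells n p. (cell_rel n k c D)\<^sup>* \<inter> ?F \<times> ?F)\<^sup>*"
    unfolding coupled_rel_def
    by (rule rtrancl_UN_contract[OF sym_cell_rel cell_rel_own_cell[OF c] xy])
  moreover have "(x, y) \<in> (coupled_rel n p k ?c')\<^sup>* \<longleftrightarrow>
      (x, y) \<in> (\<Union>D \<in> cells n p. (cell_rel n k ?c' D)\<^sup>* \<inter> ?F \<times> ?F)\<^sup>*"
    unfolding coupled_rel_def
    by (rule rtrancl_UN_contract[OF sym_cell_rel cell_rel_own_cell[OF c', of _ p, unfolded split_gyrate] xy])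
  ultimately show ?thesis by simp
qed

definition components :: "nat \<Rightarrow> bool \<Rightarrow> color \<Rightarrow> (vertex set \<Rightarrow> color) \<Rightarrow> vertex set set" where
  "components n p k c = {K. \<exists>v \<in> interior_vertices n.
     K = (coupled_rel n p k c)\<^sup>* `` {v} \<and> K \<subseteq> interior_vertices n}"

lemma interior_endpoints_disjoint: "interior_vertices n \<inter> endpoints n = {}"
  by auto

lemma coupled_rel_interior:
  assumes "(x, y) \<in> coupled_rel n p k c" "x \<in> interior_vertices n"
  shows "{x, y} \<in> edges n" "c {x, y} = k"
  using assms interior_endpoints_disjoint[of n] by (auto simp: coupled_rel_eq colored_edges_def)

text \<open>In a one-colored graph the vertices of degree two are exactly the interior ones, so
  cycles are the components without endpoints. Rim links join endpoints only and cannot enlarge such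
  a component.\<close>

lemma card_cycles_eq_components:
  assumes c: "c \<in> twisted_colorings n b"
  shows "card (cycles (colored_edges n c k)) = card (components n p k c)"
proof -
  let ?E = "colored_edges n c k" and ?I = "interior_vertices n" and ?W = "coupled_rel n p k c"
  have at: "{e \<in> ?E. v \<in> e} = {e \<in> edges n. v \<in> e \<and> c e = k}" for v
    by (auto simp: colored_edges_def)
  have int: "card {e \<in> ?E. v \<in> e} = 2" if "v \<in> ?I" for v
    using c that unfolding at by (simp add: twisted_colorings_def)
  have ext: "card {e \<in> ?E. v \<in> e} \<le> Suc 0" if "v \<notin> ?I" for v
  proof -
    have "finite {e \<in> ?E. v \<in> e}" using finite_edges[of n] by (simp add: at)
    moreover have "e = e'" if "e \<in> edges n" "e' \<in> edges n" "v \<in> e" "v \<in> e'" for e e'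
      using edge_at_endpoint_unique[OF _ that] edge_vertices[OF that(1,3)] \<open>v \<notin> ?I\<close> by blast
    ultimately show ?thesis by (auto simp: card_le_Suc0_iff_eq at)
  qed
  interpret degree_two_graph ?E
  proof
    show "finite ?E" using finite_edges[of n] by (simp add: colored_edges_def)
    show "card e = 2" if "e \<in> ?E" for e using that card_edge[of e n] by (simp add: colored_edges_def)
    show "card {e \<in> ?E. v \<in> e} \<le> 2" for v using int[of v] ext[of v] by (cases "v \<in> ?I") auto
  qed
  have "v \<in> full \<longleftrightarrow> v \<in> ?I" for v
    using int[of v] ext[of v] unfolding full_def by (cases "v \<in> ?I") auto
  then have full: "full = ?I" by blast
  let ?G = "adjacency ?E"
  have GW: "?G\<^sup>* \<subseteq> ?W\<^sup>*" by (intro rtrancl_mono) (auto simp: coupled_rel_eq)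
  have WG: "?W\<^sup>* `` {v} = ?G\<^sup>* `` {v}" if "?G\<^sup>* `` {v} \<subseteq> ?I" for v
  proof
    have "?W `` (?G\<^sup>* `` {v}) \<subseteq> ?G\<^sup>* `` {v}"
    proof
      fix y assume "y \<in> ?W `` (?G\<^sup>* `` {v})"
      then obtain x where x: "(v, x) \<in> ?G\<^sup>*" "(x, y) \<in> ?W" by auto
      then have "x \<in> ?I" using that by blast
      then have "(x, y) \<in> ?G" using coupled_rel_interior[OF x(2)] by (simp add: colored_edges_def)
      then have "(v, y) \<in> ?G\<^sup>*" using x(1) by (rule rtrancl_into_rtrancl[rotated])
      then show "y \<in> ?G\<^sup>* `` {v}" by blast
    qed
    then show "?W\<^sup>* `` {v} \<subseteq> ?G\<^sup>* `` {v}" by (intro rtrancl_Image_subset) auto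
  qed (use GW in auto)
  have "(K = ?G\<^sup>* `` {v} \<and> K \<subseteq> ?I) \<longleftrightarrow> (K = ?W\<^sup>* `` {v} \<and> K \<subseteq> ?I)" for K v
    using WG[of v] GW by blast
  then show ?thesis unfolding card_cycles full components_def by simp
qed

section \<open>Cycles with and without split vertices\<close>

definition monochrome_cells :: "nat \<Rightarrow> bool \<Rightarrow> color \<Rightarrow> (vertex set \<Rightarrow> color) \<Rightarrow> vertex set" where
  "monochrome_cells n p k c = {D \<in> cells n p. sides D \<subseteq> edges n \<and> (\<forall>e \<in> sides D. c e = k)}"

lemma corner_two_sides:
  assumes "v \<in> corners D"
  shows "\<exists>e \<in> sides D. \<exists>e' \<in> sides D. v \<in> e \<and> v \<in> e' \<and> e \<noteq> e'"
proof -
  obtain i j where D: "D = (i, j)" by (cases D)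
  from assms consider "v = (i, j)" | "v = (i + 1, j)" | "v = (i, j + 1)" | "v = (i + 1, j + 1)"
    by (auto simp: D)
  then show ?thesis
  proof cases
    case 1 then show ?thesis by (intro bexI[of _ "hedge i j"] bexI[of _ "vedge i j"]) (auto simp: D)
  next
    case 2 then show ?thesis by (intro bexI[of _ "hedge i j"] bexI[of _ "vedge (i + 1) j"]) (auto simp: D)
  next
    case 3 then show ?thesis by (intro bexI[of _ "hedge i (j + 1)"] bexI[of _ "vedge i j"]) (auto simp: D)
  next
    case 4 then show ?thesis by (intro bexI[of _ "hedge i (j + 1)"] bexI[of _ "vedge (i + 1) j"]) (auto simp: D)
  qed
qed

lemma corners_interior:
  assumes "sides D \<subseteq> edges n"
  shows "corners D \<subseteq> interior_vertices n"
  using assms by (cases D) auto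

lemma corners_linked:
  assumes "\<And>u v. {u, v} \<in> sides D \<Longrightarrow> Q u \<Longrightarrow> Q v" "v \<in> corners D" "Q v" "w \<in> corners D"
  shows "Q w"
proof -
  obtain i j where D: "D = (i, j)" by (cases D)
  have eq: "Q u \<longleftrightarrow> Q v" if "{u, v} \<in> sides D" for u v
    using assms(1) that by (metis insert_commute)
  have "Q (i, j) \<longleftrightarrow> Q (i + 1, j)" "Q (i, j + 1) \<longleftrightarrow> Q (i + 1, j + 1)" "Q (i, j) \<longleftrightarrow> Q (i, j + 1)"
    by (rule eq; simp add: D hedge_def vedge_def)+
  then show ?thesis using assms(2-4) by (auto simp: D)
qed

text \<open>Two equal sides at a corner show that it is not split, and they are all the edges of
  that color there. So the color cannot leave the cell.\<close>

lemma monochrome_cell_component: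
  assumes c: "c \<in> twisted_colorings n b" and D: "D \<in> monochrome_cells n p k c" and v: "v \<in> corners D"
  shows "corners D \<inter> split_vertices n p c = {}" "(coupled_rel n p k c)\<^sup>* `` {v} = corners D"
proof -
  let ?W = "coupled_rel n p k c"
  have D': "D \<in> cells n p" "sides D \<subseteq> edges n" and k: "\<And>e. e \<in> sides D \<Longrightarrow> c e = k"
    using D by (auto simp: monochrome_cells_def)
  have nonsplit: "w \<notin> split_vertices n p c" if w: "w \<in> corners D" for w
  proof
    assume "w \<in> split_vertices n p c"
    moreover obtain e e' where "e \<in> sides D" "e' \<in> sides D" "w \<in> e" "w \<in> e'" "e \<noteq> e'"
      using corner_two_sides[OF w] by blast
    ultimately show False using splitD[of w n p c D e e'] D' k by auto
  qed
  then show "corners D \<inter> split_vertices n p c = {}" by blast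
  show "?W\<^sup>* `` {v} = corners D"
  proof
    have "?W `` corners D \<subseteq> corners D"
    proof
      fix y assume "y \<in> ?W `` corners D"
      then obtain x where x: "x \<in> corners D" "(x, y) \<in> ?W" by auto
      have xi: "x \<in> interior_vertices n" using corners_interior[OF D'(2)] x(1) by blast
      obtain e where "e \<in> sides D" "x \<in> e" using corner_two_sides[OF x(1)] by blast
      then have "{x, y} \<in> sides D"
        using nonsplit_sides_eq(3)[OF c xi nonsplit[OF x(1)] D'(1), of e e "{x, y}"]
          coupled_rel_interior[OF x(2) xi] k by simp
      then show "y \<in> corners D" using side_subset_corners by blast
    qed
    then show "?W\<^sup>* `` {v} \<subseteq> corners D" using v by (rule rtrancl_Image_subset[rotated])
    show "corners D \<subseteq> ?W\<^sup>* `` {v}"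
    proof
      fix w assume w: "w \<in> corners D"
      have "(v, w) \<in> ?W\<^sup>*"
      proof (rule corners_linked[of D "\<lambda>w. (v, w) \<in> ?W\<^sup>*" v w])
        fix x y assume xy: "{x, y} \<in> sides D" "(v, x) \<in> ?W\<^sup>*"
        then have "(x, y) \<in> ?W" using D' k by (auto simp: coupled_rel_eq colored_edges_def)
        then show "(v, y) \<in> ?W\<^sup>*" using xy(2) by simp
      qed (use v w in simp_all)
      then show "w \<in> ?W\<^sup>* `` {v}" by simp
    qed
  qed
qed

text \<open>At a vertex that is not split, both sides in a cell have the same color. Starting from
  one edge of the component, the color therefore continues from side to side around the whole cell;
  this also shows that all four sides are edges.\<close>

lemma nonsplit_component:
  assumes c: "c \<in> twisted_colorings n b" and K: "K \<in> components n p k c" "K \<inter> split_vertices n p c = {}"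
  shows "K \<in> corners ` monochrome_cells n p k c"
proof -
  let ?W = "coupled_rel n p k c"
  obtain v where v: "v \<in> interior_vertices n" "K = ?W\<^sup>* `` {v}" and KI: "K \<subseteq> interior_vertices n"
    using K(1) by (auto simp: components_def)
  have "v \<in> K" using v by simp
  have "card {e \<in> edges n. v \<in> e \<and> c e = k} = 2" using c v(1) by (simp add: twisted_colorings_def)
  then have "{e \<in> edges n. v \<in> e \<and> c e = k} \<noteq> {}" by (metis card.empty zero_neq_numeral)
  then obtain e0 where e0: "e0 \<in> edges n" "v \<in> e0" "c e0 = k" by blast
  obtain D where D: "D \<in> cells n p" "e0 \<in> sides D" using ex_cell_side[OF e0(1)] by blast
  have vD: "v \<in> corners D" using side_subset_corners D(2) e0(2) by blast
  define Q where "Q w \<longleftrightarrow> w \<in> K \<and> (\<forall>e \<in> sides D. w \<in> e \<longrightarrow> e \<in> edges n \<and> c e = k)" for w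
  have Q: "Q w" if "w \<in> K" "e \<in> sides D" "w \<in> e" "c e = k" for w e
    using that nonsplit_sides_eq(1,2)[OF c _ _ D(1), of w _ e] K(2) KI unfolding Q_def by blast
  have all: "Q w" if "w \<in> corners D" for w
  proof (rule corners_linked[OF _ vD _ that])
    show "Q v" using Q[OF \<open>v \<in> K\<close> D(2)] e0 by blast
    fix x y assume xy: "{x, y} \<in> sides D" "Q x"
    then have "{x, y} \<in> edges n" "c {x, y} = k" "x \<in> K" by (auto simp: Q_def)
    then have "(x, y) \<in> ?W" by (simp add: coupled_rel_eq colored_edges_def)
    then have "y \<in> K" using \<open>x \<in> K\<close> unfolding v(2) by auto
    then show "Q y" using Q[OF _ xy(1)] \<open>c {x, y} = k\<close> by simp
  qed
  have "D \<in> monochrome_cells n p k c"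
  proof -
    have "e \<in> edges n \<and> c e = k" if "e \<in> sides D" for e
    proof -
      have "e \<noteq> {}" using that by (cases D) (auto simp: hedge_def vedge_def)
      then obtain w where "w \<in> e" by blast
      then show ?thesis using all[of w] that side_subset_corners unfolding Q_def by blast
    qed
    then show ?thesis using D(1) by (auto simp: monochrome_cells_def)
  qed
  moreover from this have "K = corners D"
    using monochrome_cell_component(2)[OF c _ vD] v(2) by simp
  ultimately show ?thesis by blast
qed

lemma nonsplit_components_eq:
  assumes c: "c \<in> twisted_colorings n b"
  shows "{K \<in> components n p k c. K \<inter> split_vertices n p c = {}} = corners ` monochrome_cells n p k c"
proof (intro equalityI subsetI)
  fix K assume "K \<in> corners ` monochrome_cells n p k c"
  then obtain D where D: "D \<in> monochrome_cells n p k c" "K = corners D" by blast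
  have "fst D \<in> {fst D, fst D + 1}" by simp
  then have DD: "D \<in> corners D" by (cases D) auto
  have "corners D \<subseteq> interior_vertices n"
    using D(1) corners_interior by (simp add: monochrome_cells_def)
  then show "K \<in> {K \<in> components n p k c. K \<inter> split_vertices n p c = {}}"
    using monochrome_cell_component[OF c D(1) DD] DD D(2) unfolding components_def by blast
qed (use nonsplit_component[OF c] in auto)

lemma inj_corners: "inj corners"
proof (rule injI)
  fix D D' assume eq: "corners D = corners D'"
  obtain i j i' j' where D: "D = (i, j)" "D' = (i', j')" by (cases D; cases D') auto
  have "(i, j) \<in> corners D" "(i + 1, j + 1) \<in> corners D" by (simp_all add: D)
  then show "D = D'" unfolding eq by (auto simp: D)
qed

text \<open>A monochrome cell does not alternate, so it flips as a whole. This is the reason for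
  adding the blue and the green cycle counts: these small cycles pass from one count to the
  other.\<close>

lemma monochrome_cells_gyrate:
  "monochrome_cells n p k (gyrate n p c) = monochrome_cells n p (flip k) c"
proof -
  have "(\<forall>e \<in> sides D. gyrate n p c e = k) \<longleftrightarrow> (\<forall>e \<in> sides D. c e = flip k)"
    if D: "D \<in> cells n p" "sides D \<subseteq> edges n" for D
  proof (cases "alternating n c D")
    case True
    have no: "\<not> (\<forall>e \<in> sides D. d e = l)" if "alternating n d D" for d l
    proof -
      have "D \<in> corners D" by (cases D) auto
      then obtain e e' where "e \<in> sides D" "e' \<in> sides D" "D \<in> e" "D \<in> e'" "e \<noteq> e'"
        using corner_two_sides by blast
      then show ?thesis using alternating_neq[OF that] by metis
    qed
    have "alternating n (gyrate n p c) D" using True alternating_gyrate[OF D(1)] by simp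
    then show ?thesis using no True by blast
  next
    case False
    then have g: "gyrate n p c e = flip (c e)" if "e \<in> sides D" for e
      using that gyrate_side[OF D(1) that] D(2) by auto
    have "gyrate n p c e = k \<longleftrightarrow> c e = flip k" if "e \<in> sides D" for e
      unfolding g[OF that] by simp
    then show ?thesis by blast
  qed
  then show ?thesis unfolding monochrome_cells_def by blast
qed

text \<open>Only the trace of a component on the split vertices is known to persist, so components
  are counted by their traces. A nonempty trace determines its component, and as endpoints are
  split, it also shows whether the component reaches the rim.\<close>

lemma card_split_components:
  assumes c: "c \<in> twisted_colorings n b"
  shows "card {K \<in> components n p k c. K \<inter> split_vertices n p c \<noteq> {}} =
    card {L. \<exists>x \<in> split_vertices n p c.
      L = (coupled_rel n p k c)\<^sup>* `` {x} \<inter> split_vertices n p c \<and> L \<subseteq> interior_vertices n}"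
    (is "card ?A = card ?B")
proof (rule bij_betw_same_card)
  let ?W = "coupled_rel n p k c" and ?F = "split_vertices n p c" and ?I = "interior_vertices n"
  have cls: "K = ?W\<^sup>* `` {x}" if "K \<in> components n p k c" "x \<in> K" for K x
  proof -
    obtain v where "K = ?W\<^sup>* `` {v}" using \<open>K \<in> components n p k c\<close> by (auto simp: components_def)
    then show ?thesis using sym_rtrancl_Image_eq[OF sym_coupled_rel] \<open>x \<in> K\<close> by blast
  qed
  have vert: "?W\<^sup>* `` {x} \<subseteq> ?I \<union> endpoints n" if "x \<in> ?I \<union> endpoints n" for x
  proof (rule rtrancl_Image_subset[OF that])
    have "y \<in> ?I \<union> endpoints n" if "(u, y) \<in> ?W" for u y
      using that edge_vertices[of "{u, y}" n y] by (auto simp: coupled_rel_eq colored_edges_def)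
    then show "?W `` (?I \<union> endpoints n) \<subseteq> ?I \<union> endpoints n" by blast
  qed
  show "bij_betw (\<lambda>K. K \<inter> ?F) ?A ?B"
    unfolding bij_betw_def
  proof
    show "inj_on (\<lambda>K. K \<inter> ?F) ?A"
    proof (rule inj_onI)
      fix K K' assume K: "K \<in> ?A" "K' \<in> ?A" "K \<inter> ?F = K' \<inter> ?F"
      then obtain x where "x \<in> K \<inter> ?F" by blast
      then have "x \<in> K" "x \<in> K'" using K(3) by blast+
      then show "K = K'" using cls K(1,2) by blast
    qed
    show "(\<lambda>K. K \<inter> ?F) ` ?A = ?B"
    proof (intro equalityI subsetI)
      fix L assume "L \<in> (\<lambda>K. K \<inter> ?F) ` ?A"
      then obtain K x where K: "K \<in> components n p k c" "L = K \<inter> ?F" "x \<in> K" "x \<in> ?F" by blast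
      moreover have "K \<subseteq> ?I" using K(1) by (auto simp: components_def)
      ultimately show "L \<in> ?B" using cls[OF K(1,3)] by blast
    next
      fix L assume "L \<in> ?B"
      then obtain x where x: "x \<in> ?F" "L = ?W\<^sup>* `` {x} \<inter> ?F" "L \<subseteq> ?I" by blast
      have xI: "x \<in> ?I" using x by auto
      have "?W\<^sup>* `` {x} \<subseteq> ?I"
        using vert[of x] xI x(2,3) endpoints_subset_split[of n p c] by blast
      then have "?W\<^sup>* `` {x} \<in> components n p k c" using xI unfolding components_def by blast
      then show "L \<in> (\<lambda>K. K \<inter> ?F) ` ?A" using x by blast
    qed
  qed
qed

lemma num_cycles_gyrate:
  assumes c: "c \<in> twisted_colorings n b"
  shows "num_cycles n (gyrate n p c) = num_cycles n c"
proof -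
  let ?c' = "gyrate n p c"
  define B where "B k d = {L. \<exists>x \<in> split_vertices n p d.
      L = (coupled_rel n p k d)\<^sup>* `` {x} \<inter> split_vertices n p d \<and> L \<subseteq> interior_vertices n}" for k d
  have split: "card (cycles (colored_edges n d k)) = card (monochrome_cells n p k d) + card (B k d)"
    if d: "d \<in> twisted_colorings n a" for d a k
  proof -
    let ?K = "components n p k d" and ?F = "split_vertices n p d"
    have "finite ?K"
      by (rule finite_subset[of _ "Pow (interior_vertices n)"])
        (auto simp: components_def finite_vertices)
    then have "card ?K = card {K \<in> ?K. K \<inter> ?F = {}} + card {K \<in> ?K. K \<inter> ?F \<noteq> {}}"
      by (subst card_Un_disjoint[symmetric]) (auto intro: arg_cong[of _ _ card])
    then show ?thesis
      unfolding card_cycles_eq_components[OF d, of k p] nonsplit_components_eq[OF d]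
        card_split_components[OF d] B_def
      by (simp add: card_image inj_corners inj_on_subset[OF inj_corners])
  qed
  have "B k ?c' = B k c" for k
  proof -
    have "(coupled_rel n p k ?c')\<^sup>* `` {x} \<inter> split_vertices n p c =
        (coupled_rel n p k c)\<^sup>* `` {x} \<inter> split_vertices n p c" if "x \<in> split_vertices n p c" for x
      using split_connected_gyrate[OF c that] by blast
    then show ?thesis unfolding B_def split_gyrate by auto
  qed
  then show ?thesis
    unfolding num_cycles_def split[OF c] split[OF gyrate_twisted[OF c]]
    by (simp add: monochrome_cells_gyrate)
qed

section \<open>Endpoints and pairings\<close>

lemma color_eq_other: "a \<noteq> b \<Longrightarrow> a = k \<longleftrightarrow> b \<noteq> (k :: color)"
  by (cases a; cases b; cases k) auto

text \<open>Steps among the endpoints of both colors. A half-step moves path ends by one such step,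
  and since colors alternate, two steps make one rotation step within a color.\<close>

fun clockwise :: "nat \<Rightarrow> vertex \<Rightarrow> vertex" where
  "clockwise n (x, y) =
     (if y = int n + 1 then (if x < int n then (x + 1, y) else (int n + 1, int n))
      else if x = int n + 1 then (if 1 < y then (x, y - 1) else (int n, 0))
      else if y = 0 then (if 1 < x then (x - 1, y) else (0, 1))
      else (if y < int n then (x, y + 1) else (1, int n + 1)))"

fun counterclockwise :: "nat \<Rightarrow> vertex \<Rightarrow> vertex" where
  "counterclockwise n (x, y) =
     (if y = int n + 1 then (if 1 < x then (x - 1, y) else (0, int n))
      else if x = int n + 1 then (if y < int n then (x, y + 1) else (int n, int n + 1))
      else if y = 0 then (if x < int n then (x + 1, y) else (int n + 1, 1))
      else (if 1 < y then (x, y - 1) else (1, 0)))"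

lemma endpoint_sides:
  assumes "v \<in> endpoints n"
  obtains (top) x where "v = (x, int n + 1)" "1 \<le> x" "x \<le> int n"
    | (right) y where "v = (int n + 1, y)" "1 \<le> y" "y \<le> int n"
    | (bottom) x where "v = (x, 0)" "1 \<le> x" "x \<le> int n"
    | (left) y where "v = (0, y)" "1 \<le> y" "y \<le> int n"
  using assms by (cases v) (simp, metis)

lemma clockwise_endpoint:
  assumes "v \<in> endpoints n"
  shows "clockwise n v \<in> endpoints n" "counterclockwise n v \<in> endpoints n"
    "counterclockwise n (clockwise n v) = v" "clockwise n (counterclockwise n v) = v"
    "endpoint_color n (clockwise n v) = flip (endpoint_color n v)"
    "endpoint_color n (counterclockwise n v) = flip (endpoint_color n v)"
  using assms by (cases rule: endpoint_sides; simp)+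

text \<open>The other endpoint in the same cell of parity \<open>p\<close>. Whether it is the
  clockwise or the counterclockwise neighbor alternates around the rim just as the color does, so
  the color decides. Naming the direction lets two mates in succession be read as a
  rotation.\<close>

definition mate :: "nat \<Rightarrow> bool \<Rightarrow> vertex \<Rightarrow> vertex" where
  "mate n p v = (if (endpoint_color n v = Blue) = p then counterclockwise n v else clockwise n v)"

lemma mate_endpoint:
  assumes "v \<in> endpoints n"
  shows "mate n p v \<in> endpoints n" "mate n p (mate n p v) = v"
    "endpoint_color n (mate n p v) = flip (endpoint_color n v)"
  using clockwise_endpoint[OF assms] by (auto simp: mate_def simp del: endpoint_color.simps eq_flip_iff)

text \<open>An endpoint is a corner of two consecutive rim cells of opposite parity. The coordinate
  parity that picks the cell also fixes the color of the endpoint, and with it the direction of the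
  mate.\<close>

lemma mate_in_cell:
  assumes "v \<in> endpoints n"
  shows "\<exists>D \<in> cells n p. v \<in> corners D \<and> mate n p v \<in> corners D"
  using assms
proof (cases rule: endpoint_sides)
  case (top x)
  show ?thesis
    by (rule bexI[of _ "if even (x + int n) = p then (x, int n) else (x - 1, int n)"])
      (use top in \<open>auto simp: mate_def\<close>)
next
  case (right y)
  show ?thesis
    by (rule bexI[of _ "if even (int n + y) = p then (int n, y) else (int n, y - 1)"])
      (use right in \<open>auto simp: mate_def\<close>)
next
  case (bottom x)
  show ?thesis
    by (rule bexI[of _ "if even x = p then (x, 0) else (x - 1, 0)"])
      (use bottom in \<open>auto simp: mate_def\<close>)
next
  case (left y)
  show ?thesis
    by (rule bexI[of _ "if even y = p then (0, y) else (0, y - 1)"])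
      (use left in \<open>auto simp: mate_def\<close>)
qed

lemma cell_two_endpoints:
  assumes "D \<in> cells n p"
  shows "\<exists>a b. corners D \<inter> endpoints n \<subseteq> {a, b}"
proof -
  obtain i j where ij: "D = (i, j)" by (cases D)
  have "0 \<le> i" "i \<le> int n" "0 \<le> j" "j \<le> int n" using assms by (auto simp: ij)
  then have "i = 0 \<or> i = int n \<or> 0 < i \<and> i < int n" "j = 0 \<or> j = int n \<or> 0 < j \<and> j < int n"
    by linarith+
  then consider "0 < i" "i < int n" "0 < j" "j < int n"
    | "0 < i" "i < int n" "j = 0" | "0 < i" "i < int n" "j = int n"
    | "i = 0" "0 < j" "j < int n" | "i = int n" "0 < j" "j < int n"
    | "i = 0" "j = 0" | "i = int n" "j = 0" | "i = 0" "j = int n" | "i = int n" "j = int n"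
    by blast
  then show ?thesis
  proof cases
    case 1 then show ?thesis by (auto simp: ij)
  next
    case 2 then show ?thesis by (intro exI[of _ "(i, j)"] exI[of _ "(i + 1, j)"]) (auto simp: ij)
  next
    case 3 then show ?thesis by (intro exI[of _ "(i, j + 1)"] exI[of _ "(i + 1, j + 1)"]) (auto simp: ij)
  next
    case 4 then show ?thesis by (intro exI[of _ "(i, j)"] exI[of _ "(i, j + 1)"]) (auto simp: ij)
  next
    case 5 then show ?thesis by (intro exI[of _ "(i + 1, j)"] exI[of _ "(i + 1, j + 1)"]) (auto simp: ij)
  next
    case 6 then show ?thesis by (intro exI[of _ "(i + 1, j)"] exI[of _ "(i, j + 1)"]) (auto simp: ij)
  next
    case 7 then show ?thesis by (intro exI[of _ "(i, j)"] exI[of _ "(i + 1, j + 1)"]) (auto simp: ij)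
  next
    case 8 then show ?thesis by (intro exI[of _ "(i, j)"] exI[of _ "(i + 1, j + 1)"]) (auto simp: ij)
  next
    case 9 then show ?thesis by (intro exI[of _ "(i, j + 1)"] exI[of _ "(i + 1, j)"]) (auto simp: ij)
  qed
qed

lemma endpoint_cell_unique:
  assumes "u \<in> endpoints n" "C \<in> cells n p" "D \<in> cells n p" "u \<in> corners C" "u \<in> corners D"
  shows "C = D"
proof -
  obtain i j i' j' where CD: "C = (i, j)" "D = (i', j')" by (cases C; cases D) auto
  have shift: "\<not> (i = i' + 1 \<and> j = j')" "\<not> (i' = i + 1 \<and> j = j')" "\<not> (i = i' \<and> j = j' + 1)"
    "\<not> (i = i' \<and> j' = j + 1)" using assms(2,3) unfolding CD by auto
  show ?thesis
    using assms(1)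
  proof (cases rule: endpoint_sides)
    case (top x)
    then have "j = int n" "j' = int n" "i = x \<or> i + 1 = x" "i' = x \<or> i' + 1 = x"
      using assms(2-5) by (auto simp: CD)
    then show ?thesis using shift by (auto simp: CD)
  next
    case (right y)
    then have "i = int n" "i' = int n" "j = y \<or> j + 1 = y" "j' = y \<or> j' + 1 = y"
      using assms(2-5) by (auto simp: CD)
    then show ?thesis using shift by (auto simp: CD)
  next
    case (bottom x)
    then have "j = 0" "j' = 0" "i = x \<or> i + 1 = x" "i' = x \<or> i' + 1 = x"
      using assms(2-5) by (auto simp: CD)
    then show ?thesis using shift by (auto simp: CD)
  next
    case (left y)
    then have "i = 0" "i' = 0" "j = y \<or> j + 1 = y" "j' = y \<or> j' + 1 = y"
      using assms(2-5) by (auto simp: CD)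
    then show ?thesis using shift by (auto simp: CD)
  qed
qed

lemma cell_endpoints_mate:
  assumes D: "D \<in> cells n p" and u: "u \<in> corners D" "u \<in> endpoints n"
    and v: "v \<in> corners D" "v \<in> endpoints n"
  shows "v = u \<or> v = mate n p u"
proof -
  obtain C where C: "C \<in> cells n p" "u \<in> corners C" "mate n p u \<in> corners C"
    using mate_in_cell[OF u(2)] by blast
  then have "mate n p u \<in> corners D" using endpoint_cell_unique[OF u(2) C(1) D C(2) u(1)] by simp
  moreover have "mate n p u \<noteq> u"
    using mate_endpoint(3)[OF u(2), of p] by (metis eq_flip_iff)
  ultimately show ?thesis
    using cell_two_endpoints[OF D] u v mate_endpoint(1)[OF u(2), of p] by blast
qed

section \<open>The cyclic order of the endpoints\<close>

lemma length_clockwise_endpoints: "length (clockwise_endpoints n) = 4 * n"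
  by (simp add: clockwise_endpoints_def)

lemma nth_clockwise_endpoints:
  assumes "i < 4 * n"
  shows "clockwise_endpoints n ! i =
    (if i < n then (int i + 1, int n + 1)
     else if i < 2 * n then (int n + 1, 2 * int n - int i)
     else if i < 3 * n then (3 * int n - int i, 0)
     else (0, int i - 3 * int n + 1))"
  using assms by (auto simp: clockwise_endpoints_def nth_append rev_nth)

lemma set_clockwise_endpoints: "set (clockwise_endpoints n) = endpoints n"
  by (auto simp: clockwise_endpoints_def endpoints_def)

lemma distinct_clockwise_endpoints: "distinct (clockwise_endpoints n)"
  by (auto simp: clockwise_endpoints_def distinct_map inj_on_def)

lemma clockwise_nth:
  assumes "i < 4 * n"
  shows "clockwise n (clockwise_endpoints n ! i) = clockwise_endpoints n ! (Suc i mod (4 * n))"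
proof (cases "Suc i = 4 * n")
  case True
  then show ?thesis using assms by (simp add: nth_clockwise_endpoints)
next
  case False
  then have "Suc i < 4 * n" using assms by simp
  then show ?thesis
    by (auto simp: nth_clockwise_endpoints)
qed

lemma counterclockwise_nth:
  assumes "i < 4 * n"
  shows "counterclockwise n (rev (clockwise_endpoints n) ! i) = rev (clockwise_endpoints n) ! (Suc i mod (4 * n))"
proof -
  let ?xs = "clockwise_endpoints n" and ?m = "4 * n"
  \<comment> \<open>The clockwise position of the entry that comes after entry \<open>i\<close> in
    the reversed list. One clockwise step from it leads back to entry \<open>i\<close>, also across
    the wrap-around.\<close>
  define j where "j = ?m - Suc (Suc i mod ?m)"
  have m: "0 < ?m" using assms by simp
  have "Suc i mod ?m < ?m" using m by (rule mod_less_divisor)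
  then have j: "j < ?m" "rev ?xs ! (Suc i mod ?m) = ?xs ! j"
    by (simp_all add: j_def rev_nth length_clockwise_endpoints)
  have "Suc j mod ?m = ?m - Suc i"
  proof (cases "Suc i = ?m")
    case False
    then have "Suc i < ?m" using assms by simp
    then show ?thesis by (simp add: j_def)
  qed (use m in \<open>simp add: j_def\<close>)
  then have "clockwise n (?xs ! j) = rev ?xs ! i"
    using clockwise_nth[OF j(1)] assms by (simp add: rev_nth length_clockwise_endpoints)
  moreover have "?xs ! j \<in> endpoints n"
    using j(1) nth_mem[of j ?xs] by (simp add: length_clockwise_endpoints set_clockwise_endpoints)
  ultimately show ?thesis using clockwise_endpoint(3) j(2) by metis
qed

lemma cyclic_next_nth:
  assumes "distinct ys" "j < length ys"
  shows "cyclic_next ys (ys ! j) = ys ! (Suc j mod length ys)"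
  using assms by (simp add: cyclic_next_def map_of_zip_nth nth_rotate1)

text \<open>If \<open>P\<close> alternates along the list, the filter keeps every second entry, so
  the next kept entry is two steps ahead. Even length carries this pattern across the
  wrap-around.\<close>

lemma cyclic_next_filter_alternating:
  assumes d: "distinct xs" and l: "length xs = 2 * m"
    and step: "\<And>i. i < length xs \<Longrightarrow> g (xs ! i) = xs ! (Suc i mod length xs)"
    and alt: "\<And>x. x \<in> set xs \<Longrightarrow> P (g x) \<longleftrightarrow> \<not> P x"
    and x: "x \<in> set xs" "P x"
  shows "cyclic_next (filter P xs) x = g (g x)"
proof -
  define q where "q = P (xs ! 0)"
  \<comment> \<open>The position of the first kept entry; the kept positions are then
    \<open>2 * j + r\<close>.\<close>
  define r where "r = (if q then 0 else Suc 0)"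
  have P: "P (xs ! i) \<longleftrightarrow> (even i \<longleftrightarrow> q)" if "i < 2 * m" for i
    using that
  proof (induction i)
    case (Suc i)
    then have "P (xs ! Suc i) \<longleftrightarrow> \<not> P (xs ! i)"
      using step[of i] alt[of "xs ! i"] l by simp
    moreover have "P (xs ! i) \<longleftrightarrow> (even i \<longleftrightarrow> q)" using Suc by simp
    ultimately show ?case unfolding even_Suc by blast
  qed (simp add: q_def)
  have "filter P xs = filter P (map ((!) xs) [0..<2 * m])"
    using l map_nth[of xs] by simp
  also have "\<dots> = map ((!) xs) (filter (\<lambda>i. even i \<longleftrightarrow> q) [0..<2 * m])"
    unfolding filter_map by (intro arg_cong[of _ _ "map _"] filter_cong) (auto simp: P)
  also have "filter (\<lambda>i. even i \<longleftrightarrow> q) [0..<2 * m] = map (\<lambda>j. 2 * j + r) [0..<m]"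
    unfolding r_def by (induction m) auto
  finally have ys: "filter P xs = map (\<lambda>j. xs ! (2 * j + r)) [0..<m]" by (simp add: o_def)
  obtain j where j: "j < m" "x = xs ! (2 * j + r)"
  proof -
    have "x \<in> set (filter P xs)" using x by simp
    then show ?thesis unfolding ys using that by auto
  qed
  have r: "r \<le> 1" by (simp add: r_def)
  have gg: "g (g x) = xs ! (Suc (Suc (2 * j + r)) mod (2 * m))"
    using step[of "2 * j + r"] step[of "Suc (2 * j + r) mod (2 * m)"] j r l
    by (simp add: mod_Suc_eq)
  have "cyclic_next (filter P xs) (filter P xs ! j) = filter P xs ! (Suc j mod length (filter P xs))"
    using d j(1) by (intro cyclic_next_nth) (simp_all add: ys[THEN arg_cong, of length])
  then have "cyclic_next (filter P xs) x = xs ! (2 * (Suc j mod m) + r)"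
    using j by (simp add: ys)
  also have "2 * (Suc j mod m) + r = Suc (Suc (2 * j + r)) mod (2 * m)"
  proof (cases "Suc j = m")
    case True
    then have "Suc (Suc (2 * j + r)) = r + 2 * m" by simp
    moreover have "(r + 2 * m) mod (2 * m) = r" using r j(1) by simp
    ultimately have "Suc (Suc (2 * j + r)) mod (2 * m) = r" by metis
    then show ?thesis using True by simp
  qed (use j(1) r in simp)
  finally show ?thesis using gg by simp
qed

lemma next_clockwise_eq:
  assumes "v \<in> colored_endpoints n k"
  shows "next_clockwise n k v = clockwise n (clockwise n v)"
  unfolding next_clockwise_def
proof (rule cyclic_next_filter_alternating[where m = "2 * n"])
  show "endpoint_color n (clockwise n x) = k \<longleftrightarrow> endpoint_color n x \<noteq> k"
    if "x \<in> set (clockwise_endpoints n)" for x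
    using clockwise_endpoint(5)[of x n] that
    by (intro color_eq_other) (simp add: set_clockwise_endpoints del: endpoint_color.simps)
qed (use assms in \<open>simp_all add: colored_endpoints_def distinct_clockwise_endpoints
    length_clockwise_endpoints clockwise_nth set_clockwise_endpoints del: endpoint_color.simps\<close>)

lemma next_counterclockwise_eq:
  assumes "v \<in> colored_endpoints n k"
  shows "next_counterclockwise n k v = counterclockwise n (counterclockwise n v)"
  unfolding next_counterclockwise_def
proof (rule cyclic_next_filter_alternating[where m = "2 * n"])
  show "endpoint_color n (counterclockwise n x) = k \<longleftrightarrow> endpoint_color n x \<noteq> k"
    if "x \<in> set (rev (clockwise_endpoints n))" for x
    using clockwise_endpoint(6)[of x n] that
    by (intro color_eq_other) (simp add: set_clockwise_endpoints del: endpoint_color.simps)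
qed (use assms in \<open>simp_all add: colored_endpoints_def distinct_clockwise_endpoints
    length_clockwise_endpoints counterclockwise_nth set_clockwise_endpoints del: endpoint_color.simps\<close>)

section \<open>Path ends under a half-step\<close>

lemma ends_mate:
  assumes "v \<in> ends n b k"
  shows "mate n p v \<in> ends n (\<not> b) k"
  using assms mate_endpoint[of v n p]
  by (cases b; cases k; cases "endpoint_color n v"; simp add: ends_def end_color_def)

lemma mate_ends_iff:
  assumes "v \<in> endpoints n"
  shows "mate n p v \<in> ends n b k \<longleftrightarrow> v \<notin> ends n b k"
  using assms mate_endpoint[of v n p]
  by (cases b; cases k; cases "endpoint_color n v"; simp add: ends_def end_color_def)

text \<open>The endpoint of the other color in a boundary cell hangs off the coupled graph as a leaf, so
  folding it onto its mate maps coupled paths to genuine colored paths.\<close>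

lemma coupled_connected_ends:
  assumes c: "c \<in> twisted_colorings n b"
    and uv: "u \<in> ends n b k" "v \<in> ends n b k"
  shows "(u, v) \<in> (coupled_rel n p k c)\<^sup>* \<longleftrightarrow> (u, v) \<in> (adjacency (colored_edges n c k))\<^sup>*"
proof
  let ?G = "adjacency (colored_edges n c k)"
  define fold where "fold z = (if z \<in> endpoints n - ends n b k then mate n p z else z)" for z
  have step: "(fold x, fold y) \<in> ?G\<^sup>*" if xy: "(x, y) \<in> coupled_rel n p k c" for x y
  proof (cases "(x, y) \<in> ?G")
    case True
    then have e: "{x, y} \<in> edges n" "c {x, y} = k" by (auto simp: colored_edges_def)
    have "z \<in> ends n b k" if "z \<in> {x, y}" "z \<in> endpoints n" for z
      using c that e by (auto simp: twisted_colorings_def ends_def)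
    then have "x \<notin> endpoints n - ends n b k" "y \<notin> endpoints n - ends n b k" by blast+
    then have "fold x = x" "fold y = y" unfolding fold_def by auto
    then show ?thesis using r_into_rtrancl[OF True] by (simp del: adjacency_iff)
  next
    case False
    then obtain D where D: "D \<in> cells n p" "x \<in> corners D" "x \<in> endpoints n" "y \<in> corners D" "y \<in> endpoints n"
      using xy by (auto simp: coupled_rel_eq)
    then have "y = x \<or> y = mate n p x" using cell_endpoints_mate by blast
    then have "fold x = fold y"
      using mate_ends_iff[OF D(3), of p b k] mate_endpoint(1,2)[OF D(3), of p] D(3)
      by (auto simp: fold_def)
    then show ?thesis by simp
  qed
  assume "(u, v) \<in> (coupled_rel n p k c)\<^sup>*"
  then have "(fold u, fold v) \<in> ?G\<^sup>*"
  proof (induction rule: rtrancl_induct)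
    case (step y z)
    then show ?case using \<open>\<And>x y. (x, y) \<in> coupled_rel n p k c \<Longrightarrow> (fold x, fold y) \<in> ?G\<^sup>*\<close>
      by (meson rtrancl_trans)
  qed simp
  then show "(u, v) \<in> ?G\<^sup>*" using uv by (simp add: fold_def)
next
  assume "(u, v) \<in> (adjacency (colored_edges n c k))\<^sup>*"
  then show "(u, v) \<in> (coupled_rel n p k c)\<^sup>*"
    using rtrancl_mono[of "adjacency (colored_edges n c k)" "coupled_rel n p k c"]
    by (auto simp: coupled_rel_eq)
qed

definition end_pairs :: "nat \<Rightarrow> bool \<Rightarrow> color \<Rightarrow> (vertex set \<Rightarrow> color) \<Rightarrow> vertex set set" where
  "end_pairs n b k c = {{u, v} | u v. u \<in> ends n b k \<and> v \<in> ends n b k \<and> u \<noteq> v \<and>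
     (u, v) \<in> (adjacency (colored_edges n c k))\<^sup>*}"

lemma coloring_pairing_eq: "coloring_pairing n k c = end_pairs n False k c"
  unfolding coloring_pairing_def end_pairs_def ex_path_iff_rtrancl
  by (simp add: colored_endpoints_def ends_def end_color_def)

lemma mate_coupled:
  assumes "u \<in> endpoints n"
  shows "(u, mate n p u) \<in> coupled_rel n p k c"
proof -
  obtain D where "D \<in> cells n p" "u \<in> corners D" "mate n p u \<in> corners D"
    using mate_in_cell[OF assms] by blast
  then show ?thesis using assms mate_endpoint(1)[OF assms, of p] by (auto simp: coupled_rel_eq)
qed

text \<open>The new connection runs from the mate of \<open>u\<close> to \<open>u\<close> by a rim
  link, along the persisting coupled path to \<open>v\<close>, and by a link to the mate of
  \<open>v\<close>. The mates carry color \<open>k\<close> after the half-step, so this coupled path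
  comes from a genuine colored one.\<close>

lemma end_pairs_gyrate_subset:
  assumes c: "c \<in> twisted_colorings n b"
  shows "(`) (mate n p) ` end_pairs n b k c \<subseteq> end_pairs n (\<not> b) k (gyrate n p c)"
proof
  fix q assume "q \<in> (`) (mate n p) ` end_pairs n b k c"
  then obtain u v where uv: "u \<in> ends n b k" "v \<in> ends n b k" "u \<noteq> v"
      "(u, v) \<in> (adjacency (colored_edges n c k))\<^sup>*" and q: "q = {mate n p u, mate n p v}"
    unfolding end_pairs_def by auto
  have ep: "u \<in> endpoints n" "v \<in> endpoints n" using uv by (auto simp: ends_def)
  let ?W = "coupled_rel n p k (gyrate n p c)"
  have "(u, v) \<in> (coupled_rel n p k c)\<^sup>*"
    using coupled_connected_ends[OF c uv(1,2)] uv(4) by blast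
  then have "(u, v) \<in> ?W\<^sup>*"
    using split_connected_gyrate[OF c] endpoints_subset_split ep by blast
  moreover have "(mate n p u, u) \<in> ?W" "(v, mate n p v) \<in> ?W"
    using mate_coupled ep symD[OF sym_coupled_rel] by blast+
  ultimately have "(mate n p u, mate n p v) \<in> ?W\<^sup>*"
    by (meson converse_rtrancl_into_rtrancl rtrancl.rtrancl_into_rtrancl)
  then have "(mate n p u, mate n p v) \<in> (adjacency (colored_edges n (gyrate n p c) k))\<^sup>*"
    using coupled_connected_ends[OF gyrate_twisted[OF c]] ends_mate uv(1,2) by blast
  moreover have "mate n p u \<noteq> mate n p v" using mate_endpoint(2) ep uv(3) by metis
  ultimately show "q \<in> end_pairs n (\<not> b) k (gyrate n p c)"
    unfolding end_pairs_def q using ends_mate uv(1,2) by blast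
qed

lemma end_pairs_subset: "q \<in> end_pairs n b k c \<Longrightarrow> q \<subseteq> ends n b k"
  by (auto simp: end_pairs_def)

text \<open>The half-step and the mate are involutions, so the reverse inclusion is the forward one
  applied to the gyrated coloring.\<close>

lemma end_pairs_gyrate:
  assumes c: "c \<in> twisted_colorings n b"
  shows "end_pairs n (\<not> b) k (gyrate n p c) = (`) (mate n p) ` end_pairs n b k c"
proof
  show "end_pairs n (\<not> b) k (gyrate n p c) \<subseteq> (`) (mate n p) ` end_pairs n b k c"
  proof
    fix q assume q: "q \<in> end_pairs n (\<not> b) k (gyrate n p c)"
    have "gyrate n p (gyrate n p c) = c"
      using c by (intro gyrate_gyrate) (simp add: twisted_colorings_def)
    then have "mate n p ` q \<in> end_pairs n b k c"
      using end_pairs_gyrate_subset[OF gyrate_twisted[OF c], of p k p] q by auto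
    moreover have "q \<subseteq> endpoints n" using end_pairs_subset[OF q] by (auto simp: ends_def)
    then have "(\<lambda>v. mate n p (mate n p v)) ` q = (\<lambda>v. v) ` q"
      using mate_endpoint(2) by (intro image_cong) auto
    then have "mate n p ` mate n p ` q = q" by (simp add: image_image)
    ultimately show "q \<in> (`) (mate n p) ` end_pairs n b k c" by (metis imageI)
  qed
qed (rule end_pairs_gyrate_subset[OF c])

section \<open>The full gyration\<close>

definition gyration :: "nat \<Rightarrow> (vertex set \<Rightarrow> color) \<Rightarrow> vertex set \<Rightarrow> color" where
  "gyration n c = gyrate n True (gyrate n False c)"

lemma twisted_extensional: "c \<in> twisted_colorings n b \<Longrightarrow> c \<in> edges n \<rightarrow>\<^sub>E UNIV"
  by (simp add: twisted_colorings_def)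

lemma bij_betw_gyration:
  "bij_betw (gyration n) (admissible_colorings n) (admissible_colorings n)"
proof (rule bij_betwI[where g = "\<lambda>c. gyrate n False (gyrate n True c)"])
  have "gyrate n p (gyrate n p' c) \<in> twisted_colorings n False" if "c \<in> twisted_colorings n False" for c p p'
    using gyrate_twisted[OF gyrate_twisted[OF that]] by simp
  then show "gyration n \<in> admissible_colorings n \<rightarrow> admissible_colorings n"
    "(\<lambda>c. gyrate n False (gyrate n True c)) \<in> admissible_colorings n \<rightarrow> admissible_colorings n"
    by (simp_all add: gyration_def twisted_colorings_False[symmetric])
  have "gyrate n p' (gyrate n p (gyrate n p (gyrate n p' c))) = c"
    if "c \<in> twisted_colorings n False" for c p p'
    using gyrate_gyrate[OF twisted_extensional] that gyrate_twisted[OF that] by metis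
  then show "c \<in> admissible_colorings n \<Longrightarrow> gyrate n False (gyrate n True (gyration n c)) = c"
    "c \<in> admissible_colorings n \<Longrightarrow> gyration n (gyrate n False (gyrate n True c)) = c" for c
    by (simp_all add: gyration_def twisted_colorings_False[symmetric])
qed

lemma num_cycles_gyration:
  assumes "c \<in> admissible_colorings n"
  shows "num_cycles n (gyration n c) = num_cycles n c"
proof -
  have c: "c \<in> twisted_colorings n False" using assms by (simp add: twisted_colorings_False)
  show ?thesis
    unfolding gyration_def num_cycles_gyrate[OF gyrate_twisted[OF c]] num_cycles_gyrate[OF c] ..
qed

lemma coloring_pairing_gyration:
  assumes "c \<in> admissible_colorings n"
    and next_eq: "\<And>v. v \<in> colored_endpoints n k \<Longrightarrow> mate n True (mate n False v) = next_point v"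
  shows "coloring_pairing n k (gyration n c) = rotate_pairing next_point (coloring_pairing n k c)"
proof -
  have c: "c \<in> twisted_colorings n False" using assms(1) by (simp add: twisted_colorings_False)
  have "coloring_pairing n k (gyration n c) =
      (`) (mate n True) ` (`) (mate n False) ` coloring_pairing n k c"
    using end_pairs_gyrate[OF gyrate_twisted[OF c, of False], of k True] end_pairs_gyrate[OF c, of k False]
    by (simp add: coloring_pairing_eq gyration_def)
  also have "\<dots> = (\<lambda>q. (\<lambda>v. mate n True (mate n False v)) ` q) ` coloring_pairing n k c"
    by (simp add: image_image)
  also have "\<dots> = (\<lambda>q. next_point ` q) ` coloring_pairing n k c"
  proof (rule image_cong[OF refl], rule image_cong[OF refl])
    fix q v assume "q \<in> coloring_pairing n k c" "v \<in> q"
    then have "v \<in> colored_endpoints n k"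
      unfolding coloring_pairing_def by auto
    then show "mate n True (mate n False v) = next_point v" by (rule next_eq)
  qed
  finally show ?thesis by (simp add: rotate_pairing_def)
qed

text \<open>The odd half-step takes a blue endpoint clockwise to a green one. There both the parity
  and the color in the test of \<open>mate\<close> have changed, so the direction stays the
  same.\<close>

lemma mate_mate_blue:
  assumes "v \<in> colored_endpoints n Blue"
  shows "mate n True (mate n False v) = next_clockwise n Blue v"
  using assms clockwise_endpoint(5)[of v n] next_clockwise_eq[OF assms]
  by (simp add: mate_def colored_endpoints_def del: endpoint_color.simps)

lemma mate_mate_green:
  assumes "v \<in> colored_endpoints n Green"
  shows "mate n True (mate n False v) = next_counterclockwise n Green v"
  using assms clockwise_endpoint(6)[of v n] next_counterclockwise_eq[OF assms]
  by (simp add: mate_def colored_endpoints_def del: endpoint_color.simps eq_flip_iff)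

lemma inj_on_mate_mate: "inj_on (\<lambda>v. mate n p (mate n p' v)) (endpoints n)"
  by (rule inj_onI) (metis mate_endpoint(1,2))

text \<open>Equality of rotated pairings can be undone, so gyration reaches all colorings with the
  rotated data from colorings with the original data.\<close>

lemma rotate_pairing_inject:
  assumes inj: "inj_on g S" and "P \<subseteq> Pow S" "Q \<subseteq> Pow S"
  shows "rotate_pairing g P = rotate_pairing g Q \<longleftrightarrow> P = Q"
  unfolding rotate_pairing_def
  using inj_on_image_eq_iff[OF inj_on_image_Pow[OF inj]] assms(2,3) by blast

theorem mainTheorem1:
  fixes n :: nat and \<pi>B \<pi>G :: "vertex set set" and l :: int
  assumes "n \<ge> 1"
    and "is_pairing (colored_endpoints n Blue) \<pi>B"
    and "is_pairing (colored_endpoints n Green) \<pi>G"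
  shows "\<exists>f. bij_betw f (colorings_with n \<pi>B \<pi>G l)
    (colorings_with n (rotate_pairing (next_clockwise n Blue) \<pi>B)
                      (rotate_pairing (next_counterclockwise n Green) \<pi>G) l)"
proof (intro exI)
  let ?A = "admissible_colorings n"
  let ?B' = "rotate_pairing (next_clockwise n Blue)" and ?G' = "rotate_pairing (next_counterclockwise n Green)"
  have injB: "inj_on (next_clockwise n Blue) (colored_endpoints n Blue)"
    using inj_on_subset[OF inj_on_mate_mate, of "colored_endpoints n Blue" n True False]
    by (subst inj_on_cong[OF mate_mate_blue, symmetric]) (auto simp: colored_endpoints_def)
  have injG: "inj_on (next_counterclockwise n Green) (colored_endpoints n Green)"
    using inj_on_subset[OF inj_on_mate_mate, of "colored_endpoints n Green" n True False]
    by (subst inj_on_cong[OF mate_mate_green, symmetric]) (auto simp: colored_endpoints_def)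
  have \<pi>: "\<pi>B \<subseteq> Pow (colored_endpoints n Blue)" "\<pi>G \<subseteq> Pow (colored_endpoints n Green)"
    using assms(2,3) by (auto simp: is_pairing_def partition_on_def)
  have pairs: "coloring_pairing n k c \<subseteq> Pow (colored_endpoints n k)" for k c
    unfolding coloring_pairing_def by blast
  note inj = rotate_pairing_inject[OF injB pairs \<pi>(1)] rotate_pairing_inject[OF injG pairs \<pi>(2)]
  \<comment> \<open>Gyration permutes all admissible colorings, so this equivalence makes it map the
    one fiber onto the other.\<close>
  have iff: "gyration n c \<in> colorings_with n (?B' \<pi>B) (?G' \<pi>G) l \<longleftrightarrow> c \<in> colorings_with n \<pi>B \<pi>G l"
    if "c \<in> ?A" for c
    using that bij_betwE[OF bij_betw_gyration]
    by (simp add: colorings_with_def num_cycles_gyration inj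
        coloring_pairing_gyration[OF that mate_mate_blue] coloring_pairing_gyration[OF that mate_mate_green])
  have sub: "colorings_with n P Q l \<subseteq> ?A" for P Q by (auto simp: colorings_with_def)
  have "gyration n ` colorings_with n \<pi>B \<pi>G l = colorings_with n (?B' \<pi>B) (?G' \<pi>G) l"
  proof (intro equalityI subsetI)
    fix d assume d: "d \<in> colorings_with n (?B' \<pi>B) (?G' \<pi>G) l"
    then have "d \<in> gyration n ` ?A"
      using sub bij_betw_imp_surj_on[OF bij_betw_gyration[of n]] by auto
    then obtain c where "c \<in> ?A" "d = gyration n c" by blast
    then show "d \<in> gyration n ` colorings_with n \<pi>B \<pi>G l" using iff d by simp
  next
    fix d assume "d \<in> gyration n ` colorings_with n \<pi>B \<pi>G l"
    then obtain c where c: "c \<in> colorings_with n \<pi>B \<pi>G l" "d = gyration n c" by blast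
    then have "c \<in> ?A" using sub by blast
    then show "d \<in> colorings_with n (?B' \<pi>B) (?G' \<pi>G) l" using iff c by simp
  qed
  then show "bij_betw (gyration n) (colorings_with n \<pi>B \<pi>G l) (colorings_with n (?B' \<pi>B) (?G' \<pi>G) l)"
    by (rule bij_betw_subset[OF bij_betw_gyration sub])
qed

end
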